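(* For every $d\in\mathbb{N}$ there is a constant $C_d>0$, depending only on $d$, such that the following holds. Let $\alpha\in(0,1/2]$ and $\rho\in[0,1]$. If $\mu$ is a Borel probability measure on $\mathbb{R}^d$ which is mean $(\alpha,\rho)$-porous, then \[ \overline{\dim}_P(\mu)\le d-\frac{C_d\,\rho\,\alpha^d}{|\log\alpha|}. \]
   Context: Logarithms are to base $2$. $B(x,r)$ denotes the open Euclidean ball of center $x$ and radius $r$ in $\mathbb{R}^d$, and $[n]=\{0,1,\ldots,n-1\}$. Porosity of measures: for a Borel measure $\mu$ on $\mathbb{R}^d$, a point $x$ in the support of $\mu$, $r>0$ and $\varepsilon>0$, let \[ \mathrm{por}(\mu,x,r,\varepsilon)=\sup\left\{\beta:\ \exists y,\ B(y,\beta r)\subset B(x,r)\text{ and }\frac{\mu(B(y,\beta r))}{\mu(B(x,r))}\le\varepsilon\right\}. \] The measure $\mu$ is weakly mean $(\alpha,\rho,\varepsilon)$-porous if for $\mu$-almost every $x$, \[ \liminf_{n\to\infty}\frac1n\#\{i\in[n]:\mathrm{por}(\mu,x,2^{-i},\varepsilon)>\alpha\}\ge\rho. \] The measure $\mu$ is mean $(\alpha,\rho)$-porous if it is weakly mean $(\alpha,\rho,\varepsilon)$-porous for all $\varepsilon>0$. Upper packing dimension: $\overline{\dim}_P(\mu)$ is the $\mu$-essential supremum over $x$ of the upper local dimension \[ \overline{\dim}(\mu,x)=\limsup_{r\to0}\frac{\log\mu(B(x,r))}{\log r}. \] *)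

theory Defs
  imports "HOL-Probability.Probability"
begin

text \<open>
  The definitions below are meant for a finite Borel measure \<open>\<mu>\<close> and a point \<open>x\<close> of its support,
  so that \<open>measure \<mu> (ball x r)\<close> is positive for all \<open>r > 0\<close>. Outside the support, which is a
  \<open>\<mu>\<close>-null set, their values depend on the conventions \<open>a / 0 = 0\<close> and \<open>log 2 0 = 0\<close>; they
  are only used \<open>\<mu>\<close>-almost everywhere.
\<close>

text \<open>
  \<open>\<beta> = 0\<close> is always admissible (the ball is empty), and \<open>\<beta>\<close> is at most 1 when \<open>r > 0\<close>
  (the dimension being positive), so the real-valued supremum is well defined.
\<close>

definition por :: "'a::euclidean_space measure \<Rightarrow> 'a \<Rightarrow> real \<Rightarrow> real \<Rightarrow> real" where
  "por \<mu> x r \<epsilon> =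
     Sup {\<beta>. \<exists>y. ball y (\<beta> * r) \<subseteq> ball x r \<and>
                measure \<mu> (ball y (\<beta> * r)) / measure \<mu> (ball x r) \<le> \<epsilon>}"

definition weakly_mean_porous ::
    "'a::euclidean_space measure \<Rightarrow> real \<Rightarrow> real \<Rightarrow> real \<Rightarrow> bool" where
  "weakly_mean_porous \<mu> \<alpha> \<rho> \<epsilon> \<longleftrightarrow>
     (AE x in \<mu>.
        liminf (\<lambda>n. ereal (real (card {i \<in> {..<n}. por \<mu> x ((1 / 2) ^ i) \<epsilon> > \<alpha>}) / real n))
          \<ge> ereal \<rho>)"

definition mean_porous :: "'a::euclidean_space measure \<Rightarrow> real \<Rightarrow> real \<Rightarrow> bool" where
  "mean_porous \<mu> \<alpha> \<rho> \<longleftrightarrow> (\<forall>\<epsilon>>0. weakly_mean_porous \<mu> \<alpha> \<rho> \<epsilon>)"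

definition upper_local_dim :: "'a::euclidean_space measure \<Rightarrow> 'a \<Rightarrow> ereal" where
  "upper_local_dim \<mu> x =
     Limsup (at_right 0) (\<lambda>r. ereal (log 2 (measure \<mu> (ball x r)) / log 2 r))"

text \<open>
  \<open>esssup\<close> is \<open>top\<close> on functions that are not Borel measurable. This case does not arise here: the
  measure of an open ball is left-continuous in the radius, so only rational radii matter in the
  upper limit, and it is lower semicontinuous in the centre.
\<close>

definition upper_packing_dim :: "'a::euclidean_space measure \<Rightarrow> ereal" where
  "upper_packing_dim \<mu> = esssup \<mu> (upper_local_dim \<mu>)"

end

theory Submission
  imports Defs
begin

text \<open>
  The local dimension of \<open>\<mu>\<close> at \<open>x\<close> is governed by the measures of the dyadic cubes around \<open>x\<close>, and these
  are bounded from below by comparing \<open>\<mu>\<close> with a competitor. Fix a sequence of nested partitions in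
  which each cell has at most \<open>N\<close> children, and distribute mass among the children by weights
  whose sum is about 1. The quotient of the competitor and \<open>\<mu>\<close> on the cell of \<open>x\<close> in generation \<open>J\<close> then
  has a \<open>\<mu>\<close>-integral that grows at most at a tiny exponential rate, so by Markov's inequality and the
  Borel--Cantelli lemma \<open>\<mu>\<close> is, at almost every point, eventually not much smaller than the competitor.

  With uniform weights \<open>1 / N\<close> this gives only the dimension of the space. But a cell in which
  some child carries at most an \<open>\<epsilon>\<close>-fraction of the measure (a hole) may distribute its mass among
  the at most \<open>N - 1\<close> other children with weight \<open>1 / (N - 1)\<close>, which gains at least \<open>1 / N\<close> in the
  logarithm for every visited cell with a hole. What is lost at the points that enter a hole
  is negligible: by the same product argument the frequency of generations in which a typical point
  enters a hole is as small as desired once \<open>\<epsilon>\<close> is small. This is \<open>AE_neg_ln_mass_le\<close>.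

  To turn porous balls into cells with holes, dyadic grids shifted by \<open>1 / 3\<close> in some of the coordinates
  are used: each ball of radius \<open>2\<^sup>-\<^sup>n\<^sup>-\<^sup>3\<close> lies in a cube of generation \<open>n\<close> of at least one of these
  \<open>2\<^sup>d\<close> grids, and then a ball \<open>B(y, \<beta>r) \<subseteq> B(x, r)\<close> of small relative measure contains a cube
  about \<open>m \<approx> |log \<alpha>|\<close> generations further down that is almost a null set relative to the large
  cube. Grouping \<open>m\<close> generations into one makes \<open>N = 2\<^sup>m\<^sup>d\<close>, which is of order \<open>\<alpha>\<^sup>-\<^sup>d\<close>; the starting level
  modulo \<open>m\<close> and the shift give \<open>2\<^sup>d m\<close> sequences of partitions. Of the at least \<open>\<rho> n\<close> porous scales
  up to \<open>n\<close>, these sequences see on average a proportion \<open>1 / (2\<^sup>d m)\<close>, so the total gain is of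
  order \<open>\<rho> n / (N m)\<close>, that is of order \<open>\<rho> n \<alpha>\<^sup>d / |log \<alpha>|\<close>.
\<close>

section \<open>Nested partitions and almost sure bounds for products\<close>

text \<open>
  A sequence of nested countable partitions of a probability space, in which every cell splits into
  at most \<open>N\<close> cells of the next generation. The partition of generation \<open>j\<close> consists of the fibres of
  \<open>q j\<close>, so that a cell is named by a value of \<open>q j\<close>.
\<close>

locale refining_partitions = prob_space M for M :: "'a measure" +
  fixes q :: "nat \<Rightarrow> 'a \<Rightarrow> 'c::countable" and N :: nat
  assumes space_UNIV: "space M = UNIV"
    and measurable_q [measurable]: "\<And>j. q j \<in> measurable M (count_space UNIV)"
    and refine: "\<And>j x y. q (Suc j) x = q (Suc j) y \<Longrightarrow> q j x = q j y"
    and finite_children: "\<And>j x. finite (q (Suc j) ` {y. q j y = q j x})"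
    and card_children: "\<And>j x. card (q (Suc j) ` {y. q j y = q j x}) \<le> N"
    and two_le_N: "2 \<le> N"
begin

definition cell :: "nat \<Rightarrow> 'a \<Rightarrow> 'a set" where
  "cell j x = {y. q j y = q j x}"

definition mass :: "nat \<Rightarrow> 'a \<Rightarrow> real" where
  "mass j x = measure M (cell j x)"

lemma sets_fibre [measurable]: "{y. q j y = c} \<in> sets M"
  using measurable_sets[OF measurable_q, of "{c}" j] by (simp add: space_UNIV vimage_def)

lemma sets_cell [measurable]: "cell j x \<in> sets M"
  by (simp add: cell_def)

lemma cell_cong: "q j x = q j y \<Longrightarrow> cell j x = cell j y"
  by (simp add: cell_def)

lemma mass_cong: "q j x = q j y \<Longrightarrow> mass j x = mass j y"
  by (simp add: cell_def mass_def)

lemma emeasure_cell: "emeasure M (cell j x) = ennreal (mass j x)"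
  by (simp add: mass_def emeasure_eq_measure)

lemma mass_nonneg [simp]: "0 \<le> mass j x"
  by (simp add: mass_def)

lemma q_coarsen: "q j x = q j y \<Longrightarrow> i \<le> j \<Longrightarrow> q i x = q i y"
  by (rotate_tac, induction rule: inc_induct) (auto intro: refine)

lemma measurable_of_cells:
  assumes "\<And>x y. q j x = q j y \<Longrightarrow> f x = f y"
  shows "f \<in> measurable M (count_space UNIV)"
proof -
  have "f = (\<lambda>c. f (SOME y. q j y = c)) \<circ> q j"
  proof
    fix x
    have "q j (SOME y. q j y = q j x) = q j x"
      by (rule someI) simp
    then show "f x = ((\<lambda>c. f (SOME y. q j y = c)) \<circ> q j) x"
      using assms by (metis comp_apply)
  qed
  then show ?thesis
    by (metis measurable_comp measurable_count_space_eq1 measurable_q Pi_UNIV UNIV_I space_count_space)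
qed

lemma borel_measurable_of_cells:
  fixes f :: "'a \<Rightarrow> 'b::topological_space"
  assumes "\<And>x y. q j x = q j y \<Longrightarrow> f x = f y"
  shows "f \<in> borel_measurable M"
  using measurable_of_cells[of j f, OF assms] 
  by (rule measurable_compose) (auto simp: measurable_count_space_eq1) 

lemma AE_mass_pos: "AE x in M. \<forall>j. 0 < mass j x"
proof -
  have "AE x in M. measure M {y. q j y = c} = 0 \<longrightarrow> q j x \<noteq> c" for j c
  proof (cases "measure M {y. q j y = c} = 0")
    case True
    have "{y. q j y = c} \<in> null_sets M"
      using True by (auto simp: null_sets_def emeasure_eq_measure)
    from AE_not_in[OF this] show ?thesis
      by eventually_elim auto
  qed simp
  then have "AE x in M. \<forall>j c. measure M {y. q j y = c} = 0 \<longrightarrow> q j x \<noteq> c"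
    by (simp add: AE_all_countable)
  then show ?thesis
    by eventually_elim (auto simp: mass_def cell_def zero_less_measure_iff)
qed

text \<open>
  Integrals over the whole space are compared cell by cell; the countably many cells of one
  generation are summed with the counting measure.
\<close>

lemma nn_integral_mono_cells:
  assumes [measurable]: "F \<in> borel_measurable M" "G \<in> borel_measurable M"
    and le: "\<And>x. (\<integral>\<^sup>+y. F y * indicator (cell j x) y \<partial>M) \<le> (\<integral>\<^sup>+y. G y * indicator (cell j x) y \<partial>M)"
  shows "(\<integral>\<^sup>+x. F x \<partial>M) \<le> (\<integral>\<^sup>+x. G x \<partial>M)"
proof -
  have split: "(\<integral>\<^sup>+x. H x \<partial>M)
      = (\<integral>\<^sup>+c. (\<integral>\<^sup>+x. H x * indicator {y. q j y = c} x \<partial>M) \<partial>count_space UNIV)"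
    if [measurable]: "H \<in> borel_measurable M" for H :: "'a \<Rightarrow> ennreal"
  proof -
    have "H x = (\<integral>\<^sup>+c. H x * indicator {y. q j y = c} x \<partial>count_space UNIV)" for x
    proof -
      have "(\<integral>\<^sup>+c. H x * indicator {y. q j y = c} x \<partial>count_space UNIV)
          = (\<integral>\<^sup>+c. H x * indicator {q j x} c \<partial>count_space UNIV)"
        by (intro nn_integral_cong) (auto simp: indicator_def)
      then show ?thesis
        by (simp add: nn_integral_cmult)
    qed
    then have "(\<integral>\<^sup>+x. H x \<partial>M)
        = (\<integral>\<^sup>+x. (\<integral>\<^sup>+c. H x * indicator {y. q j y = c} x \<partial>count_space UNIV) \<partial>M)"
      by (rule nn_integral_cong)
    also have "\<dots> = (\<integral>\<^sup>+c. (\<integral>\<^sup>+x. H x * indicator {y. q j y = c} x \<partial>M) \<partial>count_space UNIV)"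
      by (rule nn_integral_count_space_nn_integral) auto
    finally show ?thesis .
  qed
  have "(\<integral>\<^sup>+x. F x * indicator {y. q j y = c} x \<partial>M)
      \<le> (\<integral>\<^sup>+x. G x * indicator {y. q j y = c} x \<partial>M)" for c
  proof (cases "c \<in> range (q j)")
    case True
    then obtain x where "c = q j x" by auto
    then show ?thesis using le[of x] by (simp add: cell_def)
  next
    case False
    then have "{y. q j y = c} = {}" by auto
    then show ?thesis by simp
  qed
  then show ?thesis
    unfolding split[OF assms(1)] split[OF assms(2)] by (rule nn_integral_mono)
qed

text \<open>
  Conditioning on generation \<open>J\<close>: the first \<open>J\<close> factors are constant on each of its cells, and
  the last one multiplies the integral over each cell by at most \<open>K\<close>.
\<close>

lemma nn_integral_prod_le:
  fixes h :: "nat \<Rightarrow> 'a \<Rightarrow> real"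
  assumes nonneg: "\<And>j x. 0 \<le> h j x" and K: "0 \<le> K"
    and cong: "\<And>j x y. q (Suc j) x = q (Suc j) y \<Longrightarrow> h j x = h j y"
    and step: "\<And>j x. (\<integral>\<^sup>+y. ennreal (h j y) * indicator (cell j x) y \<partial>M) \<le> ennreal (K * mass j x)"
  shows "(\<integral>\<^sup>+x. ennreal (\<Prod>j<J. h j x) \<partial>M) \<le> ennreal (K ^ J)"
proof (induction J)
  case 0
  show ?case by (simp add: emeasure_space_1)
next
  case (Suc J)
  define G where "G x = (\<Prod>j<J. h j x)" for x
  have G_cong: "G x = G y" if "q J x = q J y" for x y
    unfolding G_def by (intro prod.cong refl cong) (use q_coarsen[OF that] in auto)
  have G_nonneg: "0 \<le> G x" for x
    unfolding G_def by (simp add: nonneg prod_nonneg)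
  have [measurable]: "h J \<in> borel_measurable M" "G \<in> borel_measurable M"
    by (rule borel_measurable_of_cells, erule cong) (rule borel_measurable_of_cells, erule G_cong)
  have "(\<integral>\<^sup>+x. ennreal (\<Prod>j<Suc J. h j x) \<partial>M) = (\<integral>\<^sup>+x. ennreal (G x * h J x) \<partial>M)"
    by (simp add: G_def)
  also have "\<dots> \<le> (\<integral>\<^sup>+x. ennreal (K * G x) \<partial>M)"
  proof (rule nn_integral_mono_cells[where j = J])
    fix x
    have eq: "G y * indicator (cell J x) y = G x * indicator (cell J x) y" for y
      using G_cong[of y x] by (auto simp: cell_def indicator_def)
    have "(\<integral>\<^sup>+y. ennreal (G y * h J y) * indicator (cell J x) y \<partial>M)
        = (\<integral>\<^sup>+y. ennreal (G x) * (ennreal (h J y) * indicator (cell J x) y) \<partial>M)"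
      by (intro nn_integral_cong)
        (auto simp: cell_def indicator_def ennreal_mult nonneg G_nonneg dest: G_cong)
    also have "\<dots> = ennreal (G x) * (\<integral>\<^sup>+y. ennreal (h J y) * indicator (cell J x) y \<partial>M)"
      by (subst nn_integral_cmult) auto
    also have "\<dots> \<le> ennreal (G x) * ennreal (K * mass J x)"
      by (intro mult_left_mono step) simp
    also have "\<dots> = ennreal (K * G x) * emeasure M (cell J x)"
      by (simp add: emeasure_cell ennreal_mult G_nonneg K mult_ac)
    also have "\<dots> = (\<integral>\<^sup>+y. ennreal (K * G x) * indicator (cell J x) y \<partial>M)"
      by (subst nn_integral_cmult_indicator) auto
    also have "\<dots> = (\<integral>\<^sup>+y. ennreal (K * G y) * indicator (cell J x) y \<partial>M)"
      by (intro nn_integral_cong) (auto simp: cell_def indicator_def dest: G_cong)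
    finally show "(\<integral>\<^sup>+y. ennreal (G y * h J y) * indicator (cell J x) y \<partial>M) \<le> \<dots>" .
  qed measurable
  also have "\<dots> = ennreal K * (\<integral>\<^sup>+x. ennreal (G x) \<partial>M)"
    using K G_nonneg by (simp add: ennreal_mult nn_integral_cmult)
  also have "\<dots> \<le> ennreal K * ennreal (K ^ J)"
    using Suc.IH by (intro mult_left_mono) (auto simp: G_def)
  finally show ?case
    using K by (simp add: ennreal_mult)
qed

text \<open>
  By Markov's inequality the exceptional set in generation \<open>J\<close> has measure at most \<open>(K / L)\<^sup>J\<close>, which is
  summable.
\<close>

lemma AE_eventually_prod_le:
  fixes h :: "nat \<Rightarrow> 'a \<Rightarrow> real"
  assumes nonneg: "\<And>j x. 0 \<le> h j x" and K: "0 < K" "K < L"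
    and cong: "\<And>j x y. q (Suc j) x = q (Suc j) y \<Longrightarrow> h j x = h j y"
    and step: "\<And>j x. (\<integral>\<^sup>+y. ennreal (h j y) * indicator (cell j x) y \<partial>M) \<le> ennreal (K * mass j x)"
  shows "AE x in M. \<forall>\<^sub>F J in sequentially. (\<Prod>j<J. h j x) \<le> L ^ J"
proof -
  define A where "A J = {x \<in> space M. 1 \<le> ennreal ((1 / L) ^ J) * ennreal (\<Prod>j<J. h j x)}" for J
  have L: "0 < L" using K by simp
  have [measurable]: "h j \<in> borel_measurable M" for j
    by (rule borel_measurable_of_cells, erule cong)
  have A_sets: "A J \<in> sets M" for J
    unfolding A_def by measurable
  have "emeasure M (A J) \<le> ennreal ((K / L) ^ J)" for J
  proof -
    have "emeasure M (A J) \<le> ennreal ((1 / L) ^ J) * (\<integral>\<^sup>+x. ennreal (\<Prod>j<J. h j x) * indicator (space M) x \<partial>M)"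
      unfolding A_def by (rule nn_integral_Markov_inequality) auto
    also have "\<dots> = ennreal ((1 / L) ^ J) * (\<integral>\<^sup>+x. ennreal (\<Prod>j<J. h j x) \<partial>M)"
      by (simp add: space_UNIV)
    also have "\<dots> \<le> ennreal ((1 / L) ^ J) * ennreal (K ^ J)"
      using nn_integral_prod_le[of h K J, OF nonneg _ cong step] K
      by (intro mult_left_mono) auto
    also have "\<dots> = ennreal ((K / L) ^ J)"
      using K L by (simp add: ennreal_mult[symmetric] power_divide)
    finally show ?thesis .
  qed
  then have le: "measure M (A J) \<le> (K / L) ^ J" for J
    using K L by (simp add: emeasure_eq_measure)
  have "summable (\<lambda>J. measure M (A J))"
    by (rule summable_comparison_test'[of "\<lambda>J. (K / L) ^ J" 0])
      (use K L le in \<open>auto intro!: summable_geometric\<close>)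
  then have "AE x in M. \<forall>\<^sub>F J in sequentially. x \<in> space M - A J"
    by (intro borel_cantelli_AE1 A_sets) (auto simp: emeasure_eq_measure)
  then show ?thesis
  proof eventually_elim
    case (elim x)
    then show ?case
    proof eventually_elim
      case (elim J)
      then have "\<not> 1 \<le> ennreal ((1 / L) ^ J * (\<Prod>j<J. h j x))"
        using L by (simp add: A_def space_UNIV ennreal_mult prod_nonneg nonneg)
      then have "(1 / L) ^ J * (\<Prod>j<J. h j x) < 1"
        by (metis ennreal_1 ennreal_leI linorder_not_less)
      then show ?case
        using L by (simp add: field_simps)
    qed
  qed
qed

section \<open>Holes and the gain that they cause\<close>

text \<open>
  A set with one point in each child of the cell of \<open>x\<close>. Sums over children become sums over
  such points, on which functions defined on the whole space can be evaluated.
\<close>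

definition transversal :: "nat \<Rightarrow> 'a \<Rightarrow> 'a set \<Rightarrow> bool" where
  "transversal j x T \<longleftrightarrow> T \<subseteq> cell j x \<and> inj_on (q (Suc j)) T \<and> q (Suc j) ` cell j x = q (Suc j) ` T"

lemma transversal_exists: "\<exists>T. transversal j x T"
  using subset_image_inj[of "q (Suc j) ` cell j x" "q (Suc j)" "cell j x"]
  unfolding transversal_def by blast

lemma transversal_q: "transversal j x T \<Longrightarrow> t \<in> T \<Longrightarrow> q j t = q j x"
  by (auto simp: transversal_def cell_def)

lemma transversal_cover: "transversal j x T \<Longrightarrow> y \<in> cell j x \<Longrightarrow> \<exists>t\<in>T. q (Suc j) y = q (Suc j) t"
  unfolding transversal_def by (metis imageE imageI)

lemma transversal_finite:
  assumes "transversal j x T"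
  shows "finite T"
proof (rule finite_imageD)
  have "q (Suc j) ` T = q (Suc j) ` {y. q j y = q j x}"
    using assms unfolding transversal_def cell_def by (elim conjE) (rule sym)
  then show "finite (q (Suc j) ` T)"
    by (simp only: finite_children)
  show "inj_on (q (Suc j)) T"
    using assms unfolding transversal_def by (elim conjE)
qed

lemma transversal_card:
  assumes "transversal j x T"
  shows "card T \<le> N"
proof -
  have "card T = card (q (Suc j) ` T)"
    using assms unfolding transversal_def by (elim conjE) (rule card_image[symmetric])
  also have "q (Suc j) ` T = q (Suc j) ` {y. q j y = q j x}"
    using assms unfolding transversal_def cell_def by (elim conjE) (rule sym)
  finally show ?thesis
    by (simp only: card_children)
qed

lemma nn_integral_cell:
  fixes f :: "'a \<Rightarrow> real"
  assumes T: "transversal j x T" and nonneg: "\<And>y. 0 \<le> f y"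
    and cong: "\<And>y z. q (Suc j) y = q (Suc j) z \<Longrightarrow> f y = f z"
  shows "(\<integral>\<^sup>+y. ennreal (f y) * indicator (cell j x) y \<partial>M) = ennreal (\<Sum>t\<in>T. f t * mass (Suc j) t)"
proof -
  have "ennreal (f y) * indicator (cell j x) y
      = (\<Sum>t\<in>T. ennreal (f t) * indicator (cell (Suc j) t) y)" for y
  proof (cases "y \<in> cell j x")
    case True
    obtain t where t: "t \<in> T" "q (Suc j) y = q (Suc j) t"
      using transversal_cover[OF T True] by blast
    have "inj_on (q (Suc j)) T"
      using T by (simp only: transversal_def)
    then have mem: "y \<in> cell (Suc j) s \<longleftrightarrow> t = s" if "s \<in> T" for s
      unfolding cell_def mem_Collect_eq t(2) using inj_on_eq_iff t(1) that by metis
    have "(\<Sum>s\<in>T. ennreal (f s) * indicator (cell (Suc j) s) y)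
        = (\<Sum>s\<in>T. if t = s then ennreal (f s) else 0)"
      by (intro sum.cong refl) (simp add: mem indicator_def)
    also have "\<dots> = ennreal (f t)"
      using t transversal_finite[OF T] by simp
    finally show ?thesis
      using True cong[OF t(2)] by simp
  next
    case False
    have "y \<notin> cell (Suc j) t" if "t \<in> T" for t
      using transversal_q[OF T that] False refine[of j y t] by (auto simp: cell_def)
    then show ?thesis
      using False by simp
  qed
  then have "(\<integral>\<^sup>+y. ennreal (f y) * indicator (cell j x) y \<partial>M)
      = (\<Sum>t\<in>T. ennreal (f t) * emeasure M (cell (Suc j) t))"
    by (simp add: nn_integral_sum nn_integral_cmult_indicator)
  also have "\<dots> = ennreal (\<Sum>t\<in>T. f t * mass (Suc j) t)"
    by (simp add: emeasure_cell nonneg ennreal_mult[symmetric] sum_ennreal)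
  finally show ?thesis .
qed

text \<open>
  \<open>hole\<close> is a property of the child that contains \<open>x\<close>, \<open>holed\<close> of the cell that contains \<open>x\<close>: some child
  of it, not necessarily that of \<open>x\<close>, has a small relative measure.
\<close>

definition hole :: "real \<Rightarrow> nat \<Rightarrow> 'a \<Rightarrow> bool" where
  "hole \<epsilon> j x \<longleftrightarrow> mass (Suc j) x \<le> \<epsilon> * mass j x"

definition holed :: "real \<Rightarrow> nat \<Rightarrow> 'a \<Rightarrow> bool" where
  "holed \<epsilon> j x \<longleftrightarrow> (\<exists>y\<in>cell j x. hole \<epsilon> j y)"

lemma hole_cong: "q (Suc j) x = q (Suc j) y \<Longrightarrow> hole \<epsilon> j x = hole \<epsilon> j y"
  using refine[of j x y] mass_cong[of j x y] mass_cong[of "Suc j" x y] by (simp add: hole_def)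

lemma holed_cong: "q j x = q j y \<Longrightarrow> holed \<epsilon> j x = holed \<epsilon> j y"
  using cell_cong[of j x y] by (simp add: holed_def)

text \<open>
  The children that are holes carry together at most a proportion \<open>N \<epsilon>\<close> of their cell. A factor
  \<open>1 / (N \<epsilon>)\<close> for each visit to a hole therefore makes the integral grow by at most a factor 2 per
  generation, so that the product is eventually at most \<open>4\<^sup>J\<close>; the value of \<open>\<epsilon>\<close> makes \<open>1 / (N \<epsilon>)\<close> so
  large that this leaves room for at most \<open>\<eta> J\<close> visits.
\<close>

lemma AE_few_holes:
  assumes \<eta>: "0 < \<eta>" and \<epsilon>: "\<epsilon> = 4 powr (- 1 / \<eta>) / real N"
  shows "AE x in M. \<forall>\<^sub>F J in sequentially. real (card {j \<in> {..<J}. hole \<epsilon> j x}) \<le> \<eta> * real J"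
proof -
  define A where "A = 4 powr (1 / \<eta>)"
  define h where "h j x = (if hole \<epsilon> j x then A else 1)" for j x
  have A: "1 \<le> A" "0 \<le> A" and A\<epsilon>: "A * \<epsilon> * real N = 1"
    using \<eta> two_le_N ge_one_powr_ge_zero[of 4 "1 / \<eta>"] by (auto simp: A_def \<epsilon> powr_minus_divide)
  have h_nonneg: "0 \<le> h j x" for j x
    using A by (simp add: h_def)
  have cong: "h j x = h j y" if "q (Suc j) x = q (Suc j) y" for j x y
    using hole_cong[OF that] by (simp add: h_def)
  have step: "(\<integral>\<^sup>+y. ennreal (h j y) * indicator (cell j x) y \<partial>M) \<le> ennreal (2 * mass j x)" for j x
  proof -
    obtain T where T: "transversal j x T"
      using transversal_exists by blast
    have total: "(\<Sum>t\<in>T. mass (Suc j) t) = mass j x"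
      using nn_integral_cell[OF T, of "\<lambda>_. 1"] by (simp add: emeasure_cell sum_nonneg)
    have "(\<Sum>t\<in>T. h j t * mass (Suc j) t) \<le> (\<Sum>t\<in>T. mass (Suc j) t + A * \<epsilon> * mass j x)"
    proof (rule sum_mono)
      fix t assume "t \<in> T"
      then have "mass j t = mass j x"
        using transversal_q[OF T] mass_cong by blast
      then show "h j t * mass (Suc j) t \<le> mass (Suc j) t + A * \<epsilon> * mass j x"
        using A mult_left_mono[of "mass (Suc j) t" "\<epsilon> * mass j x" A] \<epsilon>
        by (auto simp: h_def hole_def mult.assoc intro: add_increasing)
    qed
    also have "\<dots> = mass j x + A * \<epsilon> * real (card T) * mass j x"
      by (simp add: sum.distrib total)
    also have "\<dots> \<le> mass j x + A * \<epsilon> * real N * mass j x"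
      using transversal_card[OF T] A \<epsilon> by (intro add_left_mono mult_right_mono mult_left_mono) auto
    finally have "(\<Sum>t\<in>T. h j t * mass (Suc j) t) \<le> 2 * mass j x"
      using A\<epsilon> by simp
    moreover have "(\<integral>\<^sup>+y. ennreal (h j y) * indicator (cell j x) y \<partial>M)
        = ennreal (\<Sum>t\<in>T. h j t * mass (Suc j) t)"
      by (rule nn_integral_cell[OF T h_nonneg cong])
    ultimately show ?thesis
      by (simp add: ennreal_leI)
  qed
  have "AE x in M. \<forall>\<^sub>F J in sequentially. (\<Prod>j<J. h j x) \<le> 4 ^ J"
    by (rule AE_eventually_prod_le[OF h_nonneg _ _ cong step]) simp_all
  then show ?thesis
  proof eventually_elim
    case (elim x)
    then show ?case
    proof eventually_elim
      case (elim J)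
      let ?n = "card {j \<in> {..<J}. hole \<epsilon> j x}"
      have "(\<Prod>j<J. h j x) = A ^ ?n"
        by (simp add: h_def prod.inter_filter[symmetric])
      also have "\<dots> = 4 powr (real ?n / \<eta>)"
        by (simp add: A_def powr_realpow[symmetric] powr_powr)
      finally have "(4::real) powr (real ?n / \<eta>) \<le> 4 powr (real J)"
        using elim by (simp add: powr_realpow)
      then show ?case
        using \<eta> by (simp add: field_simps)
    qed
  qed
qed

text \<open>
  The comparison with a competitor that passes mass from a cell to its children by the weights \<open>w\<close>,
  starting from the measure itself in generation 0. The product lemma applies to the factors
  \<open>w j * mass j / mass (Suc j)\<close>, whose product telescopes to the quotient of competitor and measure.
\<close>

lemma AE_mass_ge_weights:
  fixes w :: "nat \<Rightarrow> 'a \<Rightarrow> real"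
  assumes w: "\<And>j x. 0 \<le> w j x" and K: "0 < K" "K < L"
    and cong: "\<And>j x y. q (Suc j) x = q (Suc j) y \<Longrightarrow> w j x = w j y"
    and sum_le: "\<And>j x T. transversal j x T \<Longrightarrow> (\<Sum>t\<in>T. w j t) \<le> K"
  shows "AE x in M. \<forall>\<^sub>F J in sequentially. (\<Prod>j<J. w j x) * mass 0 x \<le> L ^ J * mass J x"
proof -
  define h where "h j x = w j x * mass j x / mass (Suc j) x" for j x
  have h_cong: "h j x = h j y" if "q (Suc j) x = q (Suc j) y" for j x y
    using cong[OF that] mass_cong[OF that] mass_cong[OF refine[OF that]] by (simp add: h_def)
  have h_nonneg: "0 \<le> h j x" for j x
    by (simp add: h_def w)
  have step: "(\<integral>\<^sup>+y. ennreal (h j y) * indicator (cell j x) y \<partial>M) \<le> ennreal (K * mass j x)" for j x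
  proof -
    obtain T where T: "transversal j x T"
      using transversal_exists by blast
    have "(\<Sum>t\<in>T. h j t * mass (Suc j) t) \<le> (\<Sum>t\<in>T. w j t * mass j x)"
    proof (rule sum_mono)
      fix t assume "t \<in> T"
      then have "mass j t = mass j x"
        using transversal_q[OF T] mass_cong by blast
      then show "h j t * mass (Suc j) t \<le> w j t * mass j x"
        by (simp add: h_def w)
    qed
    also have "\<dots> = (\<Sum>t\<in>T. w j t) * mass j x"
      by (simp add: sum_distrib_right)
    also have "\<dots> \<le> K * mass j x"
      using sum_le[OF T] by (intro mult_right_mono) auto
    finally show ?thesis
      by (simp add: nn_integral_cell[OF T h_nonneg h_cong] ennreal_leI)
  qed
  have "AE x in M. \<forall>\<^sub>F J in sequentially. (\<Prod>j<J. h j x) \<le> L ^ J"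
    by (rule AE_eventually_prod_le[OF h_nonneg K h_cong step])
  with AE_mass_pos
  show ?thesis
  proof eventually_elim
    case (elim x)
    \<comment> \<open>In the factors, division by a vanishing mass gives 0; it does not occur along the cells of a typical point.\<close>
    have tele: "(\<Prod>j<J. h j x) * mass J x = (\<Prod>j<J. w j x) * mass 0 x" for J
    proof (induction J)
      case (Suc J)
      have last: "h J x * mass (Suc J) x = w J x * mass J x"
        using elim(1)[rule_format, of "Suc J"] by (simp add: h_def)
      have "(\<Prod>j<Suc J. h j x) * mass (Suc J) x = (\<Prod>j<J. h j x) * (h J x * mass (Suc J) x)"
        by simp
      also have "\<dots> = w J x * ((\<Prod>j<J. h j x) * mass J x)"
        unfolding last by simp
      also have "\<dots> = (\<Prod>j<Suc J. w j x) * mass 0 x"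
        unfolding Suc.IH by simp
      finally show ?case .
    qed simp
    from elim(2) show ?case
    proof eventually_elim
      case (elim J)
      then have "(\<Prod>j<J. h j x) * mass J x \<le> L ^ J * mass J x"
        by (intro mult_right_mono) auto
      then show ?case
        by (simp add: tele)
    qed
  qed
qed

text \<open>
  The competitor gives each child the weight \<open>1 / N\<close>, except in cells with a hole, where the holes get
  only \<open>\<kappa> / N\<close> and each of the at most \<open>N - 1\<close> other children gets \<open>1 / (N - 1)\<close>. The sum of the weights is
  at most \<open>1 + \<kappa>\<close>. Since \<open>ln (N - 1) \<le> ln N - 1 / N\<close>, each cell with a hole gains \<open>1 / N\<close>,
  and each of the at most \<open>\<eta> J\<close> visits to a hole costs at most \<open>1 / N - ln \<kappa>\<close> on top.
\<close>

lemma AE_neg_ln_mass_le: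
  assumes \<kappa>: "0 < \<kappa>" and \<eta>: "0 < \<eta>" and \<epsilon>: "\<epsilon> = 4 powr (- 1 / \<eta>) / real N"
    and \<theta>: "2 * \<kappa> + \<eta> * (1 / real N - ln \<kappa>) < \<theta>" and \<kappa>1: "\<kappa> \<le> 1"
  shows "AE x in M. \<forall>\<^sub>F J in sequentially.
     - ln (mass J x) \<le> real J * ln (real N) - real (card {j \<in> {..<J}. holed \<epsilon> j x}) / real N + \<theta> * real J"
proof -
  define w where "w j x = (if hole \<epsilon> j x then \<kappa> / real N
    else if holed \<epsilon> j x then 1 / (real N - 1) else 1 / real N)" for j x
  have N: "2 \<le> real N"
    using two_le_N by simp
  have w_pos: "0 < w j x" for j x
    using \<kappa> N by (simp add: w_def)
  have w_cong: "w j x = w j y" if "q (Suc j) x = q (Suc j) y" for j x y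
    using hole_cong[OF that] holed_cong[OF refine[OF that]] by (simp add: w_def)
  have sum_le: "(\<Sum>t\<in>T. w j t) \<le> 1 + \<kappa>"
    if T: "transversal j x T" for j x T
  proof (cases "holed \<epsilon> j x")
    case False
    have "w j t = 1 / real N" if "t \<in> T" for t
    proof -
      have *: "t \<in> cell j x" "holed \<epsilon> j t = holed \<epsilon> j x" "t \<in> cell j t"
        using transversal_q[OF T that] holed_cong[of j t x] by (auto simp: cell_def)
      with False have "\<not> hole \<epsilon> j t"
        by (auto simp: holed_def)
      with * False show ?thesis
        by (simp add: w_def)
    qed
    then have "(\<Sum>t\<in>T. w j t) = real (card T) / real N"
      by simp
    also have "\<dots> \<le> 1"
      using transversal_card[OF T] N by simp
    finally show ?thesis
      using \<kappa> by simp
  next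
    case True
    then obtain y where y: "y \<in> cell j x" "hole \<epsilon> j y"
      by (auto simp: holed_def)
    with transversal_cover[OF T] obtain t where t: "t \<in> T" "hole \<epsilon> j t"
      using hole_cong by blast
    have "card {t \<in> T. \<not> hole \<epsilon> j t} \<le> card (T - {t})"
      using t transversal_finite[OF T] by (intro card_mono) auto
    then have "card {t \<in> T. \<not> hole \<epsilon> j t} \<le> N - 1"
      using t transversal_finite[OF T] transversal_card[OF T] by simp
    then have few: "real (card {t \<in> T. \<not> hole \<epsilon> j t}) \<le> real N - 1"
      using two_le_N by linarith
    have "(\<Sum>t\<in>T. w j t) \<le> (\<Sum>t\<in>T. \<kappa> / real N + (if \<not> hole \<epsilon> j t then 1 / (real N - 1) else 0))"
    proof (rule sum_mono)
      fix t assume "t \<in> T"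
      then have "holed \<epsilon> j t"
        using True transversal_q[OF T] holed_cong by blast
      then show "w j t \<le> \<kappa> / real N + (if \<not> hole \<epsilon> j t then 1 / (real N - 1) else 0)"
        using \<kappa> by (simp add: w_def)
    qed
    also have "\<dots> = real (card T) * (\<kappa> / real N) + real (card {t \<in> T. \<not> hole \<epsilon> j t}) / (real N - 1)"
      using transversal_finite[OF T] by (simp add: sum.distrib sum.inter_filter[symmetric])
    also have "\<dots> \<le> real N * (\<kappa> / real N) + 1"
      using few N transversal_card[OF T] \<kappa> by (intro add_mono mult_right_mono) auto
    also have "\<dots> = 1 + \<kappa>"
      using N by simp
    finally show ?thesis .
  qed
  have ln_w: "- ln (w j x) \<le> ln (real N) - of_bool (holed \<epsilon> j x) / real N
      + of_bool (hole \<epsilon> j x) * (1 / real N - ln \<kappa>)" for j x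
  proof -
    have "ln ((real N - 1) / real N) \<le> (real N - 1) / real N - 1"
      using N by (intro ln_le_minus_one) auto
    moreover have "ln ((real N - 1) / real N) = ln (real N - 1) - ln (real N)"
      using N by (simp add: ln_div)
    moreover have "(real N - 1) / real N - 1 = - (1 / real N)"
      using N by (simp add: field_simps)
    ultimately have "ln (real N - 1) \<le> ln (real N) - 1 / real N"
      by linarith
    moreover have "hole \<epsilon> j x \<Longrightarrow> holed \<epsilon> j x"
      by (auto simp: holed_def cell_def)
    ultimately show ?thesis
      using N \<kappa> by (auto simp: w_def ln_div)
  qed
  have "ln \<kappa> \<le> 0" "0 \<le> 1 / real N"
    using \<kappa> \<kappa>1 by auto
  then have hole_cost: "0 \<le> 1 / real N - ln \<kappa>"
    by linarith
  define \<delta> where "\<delta> = \<theta> - (2 * \<kappa> + \<eta> * (1 / real N - ln \<kappa>))"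
  have \<delta>: "0 < \<delta>"
    using \<theta> by (simp add: \<delta>_def)
  have "AE x in M. \<forall>\<^sub>F J in sequentially. (\<Prod>j<J. w j x) * mass 0 x \<le> (1 + 2 * \<kappa>) ^ J * mass J x"
    by (rule AE_mass_ge_weights[OF less_imp_le[OF w_pos] _ _ w_cong sum_le]) (use \<kappa> in simp_all)
  with AE_few_holes[OF \<eta> \<epsilon>] AE_mass_pos
  show ?thesis
  proof eventually_elim
    case (elim x)
    obtain J0 where J0: "- ln (mass 0 x) < real J0 * \<delta>"
      using reals_Archimedean3[OF \<delta>] by blast
    have "- ln (mass 0 x) \<le> \<delta> * real J" if "J0 \<le> J" for J
    proof -
      have "real J0 * \<delta> \<le> real J * \<delta>"
        using that \<delta> by (intro mult_right_mono) auto
      with J0 show ?thesis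
        by (simp add: mult.commute)
    qed
    then have "\<forall>\<^sub>F J in sequentially. - ln (mass 0 x) \<le> \<delta> * real J"
      by (rule eventually_sequentiallyI)
    with elim(1,3) show ?case
    proof eventually_elim
      case (elim J)
      let ?H = "card {j \<in> {..<J}. hole \<epsilon> j x}" and ?P = "card {j \<in> {..<J}. holed \<epsilon> j x}"
      have "ln ((\<Prod>j<J. w j x) * mass 0 x) \<le> ln ((1 + 2 * \<kappa>) ^ J * mass J x)"
        using elim(2) \<open>\<forall>j. 0 < mass j x\<close> \<kappa> w_pos by (subst ln_le_cancel_iff) (auto simp: prod_pos)
      then have "(\<Sum>j<J. ln (w j x)) + ln (mass 0 x) \<le> real J * ln (1 + 2 * \<kappa>) + ln (mass J x)"
        using \<open>\<forall>j. 0 < mass j x\<close> \<kappa> w_pos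
        by (simp add: ln_mult ln_realpow prod_pos ln_prod less_imp_neq[symmetric])
      moreover have "real J * ln (1 + 2 * \<kappa>) \<le> real J * (2 * \<kappa>)"
        using \<kappa> by (intro mult_left_mono ln_add_one_self_le_self) auto
      moreover have "(\<Sum>j<J. - ln (w j x)) \<le> (\<Sum>j<J. ln (real N) - of_bool (holed \<epsilon> j x) / real N
          + of_bool (hole \<epsilon> j x) * (1 / real N - ln \<kappa>))"
        by (intro sum_mono ln_w)
      moreover have "\<dots> = real J * ln (real N) - real ?P / real N + real ?H * (1 / real N - ln \<kappa>)"
        by (simp add: sum.distrib sum_subtractf sum_divide_distrib[symmetric] sum_distrib_right[symmetric]
            of_bool_def sum.inter_filter[symmetric])
      moreover have "real ?H * (1 / real N - ln \<kappa>) \<le> \<eta> * real J * (1 / real N - ln \<kappa>)"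
        using elim(1) hole_cost by (intro mult_right_mono)
      ultimately show ?case
        using elim(3) by (simp add: \<delta>_def algebra_simps sum_negf)
    qed
  qed
qed

end

section \<open>Shifted dyadic grids\<close>

text \<open>
  The dyadic cube of side \<open>2\<^sup>-\<^sup>n\<close> that contains \<open>x\<close> in the dyadic grid translated by \<open>\<tau>\<close>, named by the
  integer coordinates of its corner. The translation is the same for all \<open>n\<close>, so the
  grids are nested.
\<close>

definition grid :: "real ^ 'd \<Rightarrow> nat \<Rightarrow> real ^ 'd \<Rightarrow> int ^ 'd" where
  "grid \<tau> n x = (\<chi> c. \<lfloor>2 ^ n * (x $ c - \<tau> $ c)\<rfloor>)"

lemma grid_coarsen: "grid \<tau> n x $ c = grid \<tau> (n + k) x $ c div 2 ^ k"
proof -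
  have "2 ^ (n + k) * (x $ c - \<tau> $ c) / real_of_int (2 ^ k) = 2 ^ n * (x $ c - \<tau> $ c)"
    by (simp add: power_add)
  then show ?thesis
    using floor_divide_real_eq_div[of "2 ^ k" "2 ^ (n + k) * (x $ c - \<tau> $ c)"]
    by (simp add: grid_def)
qed

lemma grid_refine: "grid \<tau> (n + k) x = grid \<tau> (n + k) y \<Longrightarrow> grid \<tau> n x = grid \<tau> n y"
  by (simp add: vec_eq_iff grid_coarsen[of \<tau> n _ _ k])

lemma grid_children:
  "finite (grid \<tau> (n + k) ` {y. grid \<tau> n y = p}) \<and>
   card (grid \<tau> (n + k) ` {y :: real ^ 'd. grid \<tau> n y = p}) \<le> 2 ^ (k * CARD('d))"
proof -
  let ?box = "PiE UNIV (\<lambda>c. {p $ c * 2 ^ k..<(p $ c + 1) * 2 ^ k})"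
  have sub: "grid \<tau> (n + k) ` {y. grid \<tau> n y = p} \<subseteq> vec_lambda ` ?box"
  proof (rule image_subsetI)
    fix y assume "y \<in> {y. grid \<tau> n y = p}"
    then have p: "p $ c = grid \<tau> (n + k) y $ c div 2 ^ k" for c
      using grid_coarsen[of \<tau> n y c k] by simp
    have "grid \<tau> (n + k) y $ c \<in> {p $ c * 2 ^ k..<(p $ c + 1) * 2 ^ k}" for c
    proof -
      define v where "v = grid \<tau> (n + k) y $ c"
      have "v div 2 ^ k * 2 ^ k + v mod 2 ^ k = v"
        by (rule div_mult_mod_eq)
      moreover have "0 \<le> v mod 2 ^ k" "v mod 2 ^ k < 2 ^ k"
        by simp_all
      ultimately have "v div 2 ^ k * 2 ^ k \<le> v" "v < (v div 2 ^ k + 1) * 2 ^ k"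
        unfolding distrib_right by linarith+
      then show ?thesis
        by (simp add: p v_def)
    qed
    then have "vec_nth (grid \<tau> (n + k) y) \<in> ?box"
      by auto
    then show "grid \<tau> (n + k) y \<in> vec_lambda ` ?box"
      by (rule image_eqI[rotated]) (simp add: vec_nth_inverse)
  qed
  have fin: "finite ?box"
    by (intro finite_PiE) auto
  have "card (vec_lambda ` ?box :: (int ^ 'd) set) \<le> card ?box"
    using fin by (rule card_image_le)
  also have "\<dots> = 2 ^ (k * CARD('d))"
    by (simp add: card_PiE algebra_simps power_mult nat_power_eq)
  finally have "card (vec_lambda ` ?box :: (int ^ 'd) set) \<le> 2 ^ (k * CARD('d))" .
  with sub fin show ?thesis
    by (meson card_mono finite_imageI finite_subset le_trans)
qed

lemma measurable_grid: "grid \<tau> n \<in> measurable borel (count_space (UNIV :: (int ^ 'd) set))"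
proof -
  have "grid \<tau> n -` {p} \<in> sets borel" for p :: "int ^ 'd"
  proof -
    have "grid \<tau> n -` {p} = (\<Inter>c. {x. \<lfloor>2 ^ n * (x $ c - \<tau> $ c)\<rfloor> = p $ c})"
      by (auto simp: grid_def vec_eq_iff)
    also have "\<dots> \<in> sets borel"
      by (intro sets.finite_INT) (simp_all add: pred_def[symmetric])
    finally show ?thesis .
  qed
  then show ?thesis
    by (simp add: measurable_count_space_eq2_countable)
qed

text \<open>
  Only every \<open>m\<close>-th level of a grid is kept, so that the passage from one generation to the next reaches
  the size of a hole. The \<open>m\<close> choices of \<open>a\<close> together use all levels.
\<close>

lemma refining_partitions_grid:
  fixes \<mu> :: "(real ^ 'd) measure"
  assumes "prob_space \<mu>" and sets: "sets \<mu> = sets borel" and m: "1 \<le> m"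
  shows "refining_partitions \<mu> (\<lambda>j. grid \<tau> (a + j * m)) (2 ^ (m * CARD('d)))"
proof -
  have lvl: "a + Suc j * m = (a + j * m) + m" for j
    by simp
  show ?thesis
    unfolding refining_partitions_def refining_partitions_axioms_def lvl
  proof (intro conjI allI impI)
    show "prob_space \<mu>" by fact
    show "space \<mu> = UNIV"
      using sets_eq_imp_space_eq[OF sets] by simp
    show "grid \<tau> (a + j * m) \<in> measurable \<mu> (count_space UNIV)" for j
      using measurable_grid by (subst measurable_cong_sets[OF sets refl])
    show "grid \<tau> (a + j * m) x = grid \<tau> (a + j * m) y"
      if "grid \<tau> (a + j * m + m) x = grid \<tau> (a + j * m + m) y" for j x y
      using that by (rule grid_refine)
    have "1 \<le> m * CARD('d)"
      using m by (simp add: Suc_le_eq)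
    then show "2 \<le> (2::nat) ^ (m * CARD('d))"
      using power_increasing[of 1 "m * CARD('d)" "2::nat"] by simp
  qed (use grid_children in blast)+
qed

lemma dist_less_of_grid_eq:
  fixes y z :: "real ^ 'd"
  assumes "grid \<tau> n y = grid \<tau> n z"
  shows "dist y z < real CARD('d) / 2 ^ n"
proof -
  have "\<bar>(y - z) $ c\<bar> < 1 / 2 ^ n" for c
  proof -
    have "\<lfloor>2 ^ n * (y $ c - \<tau> $ c)\<rfloor> = \<lfloor>2 ^ n * (z $ c - \<tau> $ c)\<rfloor>"
      using assms by (simp add: grid_def vec_eq_iff)
    then have "\<bar>2 ^ n * (y $ c - \<tau> $ c) - 2 ^ n * (z $ c - \<tau> $ c)\<bar> < 1"
      by linarith
    also have "2 ^ n * (y $ c - \<tau> $ c) - 2 ^ n * (z $ c - \<tau> $ c) = 2 ^ n * (y - z) $ c"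
      by (simp add: algebra_simps)
    finally have "2 ^ n * \<bar>(y - z) $ c\<bar> < 1"
      by (simp add: abs_mult)
    then show ?thesis
      by (simp only: pos_less_divide_eq zero_less_power zero_less_numeral mult.commute)
  qed
  then have "(\<Sum>c\<in>UNIV. \<bar>(y - z) $ c\<bar>) < (\<Sum>c\<in>(UNIV :: 'd set). 1 / 2 ^ n)"
    by (intro sum_strict_mono) auto
  then show ?thesis
    using norm_le_l1_cart[of "y - z"] by (simp add: dist_norm)
qed

definition shifts :: "(real ^ 'd) set" where
  "shifts = {\<tau>. \<forall>c. \<tau> $ c \<in> {0, 1 / 3}}"

lemma finite_shifts: "finite (shifts :: (real ^ 'd) set)"
  and card_shifts: "card (shifts :: (real ^ 'd) set) \<le> 2 ^ CARD('d)"
proof -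
  have sub: "(shifts :: (real ^ 'd) set) \<subseteq> vec_lambda ` PiE UNIV (\<lambda>_. {0, 1 / 3})"
  proof
    fix \<tau> :: "real ^ 'd" assume "\<tau> \<in> shifts"
    then have "vec_nth \<tau> \<in> PiE UNIV (\<lambda>_. {0, 1 / 3})"
      by (auto simp: shifts_def)
    then show "\<tau> \<in> vec_lambda ` PiE UNIV (\<lambda>_. {0, 1 / 3})"
      by (rule image_eqI[rotated]) (simp add: vec_nth_inverse)
  qed
  have fin: "finite (PiE (UNIV :: 'd set) (\<lambda>_. {0, 1 / 3 :: real}))"
    by (intro finite_PiE) auto
  then show "finite (shifts :: (real ^ 'd) set)"
    using sub finite_subset by blast
  have "card (shifts :: (real ^ 'd) set)
      \<le> card (vec_lambda ` PiE (UNIV :: 'd set) (\<lambda>_. {0, 1 / 3 :: real}))"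
    using sub fin by (intro card_mono) auto
  also have "\<dots> \<le> card (PiE (UNIV :: 'd set) (\<lambda>_. {0, 1 / 3 :: real}))"
    using fin by (rule card_image_le)
  also have "\<dots> = 2 ^ CARD('d)"
    by (simp add: card_PiE numeral_2_eq_2)
  finally show "card (shifts :: (real ^ 'd) set) \<le> 2 ^ CARD('d)" .
qed

text \<open>
  If the grid and its translate by \<open>1 / 3\<close> both had a boundary point within distance \<open>2\<^sup>-\<^sup>n / 8\<close> of \<open>u\<close>, then \<open>2\<^sup>n / 3\<close> would be within
  \<open>1 / 4\<close> of an integer, but it differs by \<open>1 / 3\<close> at least from every integer.
\<close>

lemma one_third_trick:
  fixes u :: real
  assumes r: "r \<le> 1 / (8 * 2 ^ n)"
  shows "\<exists>t\<in>{0, 1 / 3}. \<forall>z. \<bar>z - u\<bar> < r \<longrightarrow> \<lfloor>2 ^ n * (z - t)\<rfloor> = \<lfloor>2 ^ n * (u - t)\<rfloor>"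
proof (rule ccontr)
  assume neg: "\<not> ?thesis"
  have boundary: "\<exists>k::int. \<bar>k - 2 ^ n * (u - t)\<bar> \<le> 1 / 8" if "t \<in> {0, 1 / 3}" for t
  proof -
    have "\<not> (\<forall>z. \<bar>z - u\<bar> < r \<longrightarrow> \<lfloor>2 ^ n * (z - t)\<rfloor> = \<lfloor>2 ^ n * (u - t)\<rfloor>)"
      using neg bexI[OF _ that] by (rule contrapos_nn)
    then obtain z where z: "\<bar>z - u\<bar> < r" "\<lfloor>2 ^ n * (z - t)\<rfloor> \<noteq> \<lfloor>2 ^ n * (u - t)\<rfloor>"
      by (elim not_all[THEN iffD1, THEN exE]) (simp only: not_imp, elim conjE)
    have "\<bar>2 ^ n * (z - t) - 2 ^ n * (u - t)\<bar> = 2 ^ n * \<bar>z - u\<bar>"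
      by (simp add: right_diff_distrib[symmetric] abs_mult)
    also have "\<dots> \<le> 2 ^ n * (1 / (8 * 2 ^ n))"
      using z(1) r by (intro mult_left_mono) auto
    finally have close: "\<bar>2 ^ n * (z - t) - 2 ^ n * (u - t)\<bar> \<le> 1 / 8"
      by simp
    show ?thesis
    proof (cases "2 ^ n * (z - t) < 2 ^ n * (u - t)")
      case True
      with z(2) have "\<lfloor>2 ^ n * (z - t)\<rfloor> < \<lfloor>2 ^ n * (u - t)\<rfloor>"
        using floor_mono[of "2 ^ n * (z - t)" "2 ^ n * (u - t)"] by linarith
      then have "2 ^ n * (z - t) < of_int \<lfloor>2 ^ n * (u - t)\<rfloor>"
        by linarith
      with close show ?thesis
        by (intro exI[of _ "\<lfloor>2 ^ n * (u - t)\<rfloor>"]) linarith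
    next
      case False
      with z(2) have "\<lfloor>2 ^ n * (u - t)\<rfloor> < \<lfloor>2 ^ n * (z - t)\<rfloor>"
        using floor_mono[of "2 ^ n * (u - t)" "2 ^ n * (z - t)"] by linarith
      then have "2 ^ n * (u - t) < of_int \<lfloor>2 ^ n * (z - t)\<rfloor>"
        by linarith
      with close show ?thesis
        by (intro exI[of _ "\<lfloor>2 ^ n * (z - t)\<rfloor>"]) linarith
    qed
  qed
  from boundary[of 0] obtain k :: int where k: "\<bar>k - 2 ^ n * u\<bar> \<le> 1 / 8"
    by auto
  from boundary[of "1 / 3"] obtain l :: int where l: "\<bar>l - 2 ^ n * (u - 1 / 3)\<bar> \<le> 1 / 8"
    by auto
  have third: "2 ^ n * (u - 1 / 3) = 2 ^ n * u - 2 ^ n / 3"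
    by (simp add: right_diff_distrib)
  have "\<bar>3 * (real_of_int k - l) - 2 ^ n\<bar> < 1"
  proof -
    have "\<bar>3 * (a - b) - y\<bar> < 1" if "\<bar>a - x\<bar> \<le> 1 / 8" "\<bar>b - (x - y / 3)\<bar> \<le> 1 / 8" for a b x y :: real
      using that unfolding abs_le_iff abs_less_iff by (auto simp: field_simps)
    from this[OF k l[unfolded third]] show ?thesis .
  qed
  then have "\<bar>real_of_int (3 * (k - l) - 2 ^ n)\<bar> < 1"
    by simp
  then have "3 * (k - l) - 2 ^ n = 0"
    by linarith
  then have "(3::int) dvd 2 ^ n"
    by (metis dvd_triv_left eq_iff_diff_eq_0)
  then have "(3::int) dvd 2"
    using prime_dvd_power[of "3::int" 2 n] by simp
  then show False
    by simp
qed

lemma ball_in_shifted_cell: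
  fixes x :: "real ^ 'd"
  obtains \<tau> where "\<tau> \<in> shifts" "\<And>y. y \<in> ball x (1 / 2 ^ (n + 3)) \<Longrightarrow> grid \<tau> n y = grid \<tau> n x"
proof -
  have "\<forall>c. \<exists>t\<in>{0, 1 / 3}. \<forall>z. \<bar>z - x $ c\<bar> < 1 / 2 ^ (n + 3) \<longrightarrow>
      \<lfloor>2 ^ n * (z - t)\<rfloor> = \<lfloor>2 ^ n * (x $ c - t)\<rfloor>"
    by (intro allI one_third_trick) (simp add: power_add)
  then obtain t where t: "\<And>c. t c \<in> {0, 1 / 3}"
    "\<And>c z. \<bar>z - x $ c\<bar> < 1 / 2 ^ (n + 3) \<Longrightarrow> \<lfloor>2 ^ n * (z - t c)\<rfloor> = \<lfloor>2 ^ n * (x $ c - t c)\<rfloor>"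
    by metis
  show thesis
  proof (rule that[of "\<chi> c. t c"])
    show "(\<chi> c. t c) \<in> shifts"
      using t(1) by (simp add: shifts_def)
    fix y assume y: "y \<in> ball x (1 / 2 ^ (n + 3))"
    have "\<bar>y $ c - x $ c\<bar> < 1 / 2 ^ (n + 3)" for c
      using component_le_norm_cart[of "y - x" c] y by (simp add: dist_norm norm_minus_commute)
    then have "\<lfloor>2 ^ n * (y $ c - t c)\<rfloor> = \<lfloor>2 ^ n * (x $ c - t c)\<rfloor>" for c
      by (rule t(2))
    then show "grid (\<chi> c. t c) n y = grid (\<chi> c. t c) n x"
      by (simp add: grid_def)
  qed
qed

section \<open>Measurability of the local dimension\<close>

text \<open>
  The balls of radius \<open>r\<close> are the sections of an open set in the product space.
\<close>

lemma borel_measurable_measure_ball: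
  fixes \<mu> :: "'a::euclidean_space measure"
  assumes "finite_measure \<mu>" and sets: "sets \<mu> = sets borel"
  shows "(\<lambda>x. measure \<mu> (ball x r)) \<in> borel_measurable \<mu>"
proof -
  interpret finite_measure \<mu> by fact
  have "open {p :: 'a \<times> 'a. dist (fst p) (snd p) < r}"
    by (intro open_Collect_less continuous_intros)
  then have "{p :: 'a \<times> 'a. dist (fst p) (snd p) < r} \<in> sets (\<mu> \<Otimes>\<^sub>M \<mu>)"
    unfolding sets_pair_measure_cong[OF sets sets] borel_prod by (rule borel_open)
  from measurable_emeasure_Pair[OF this]
  have "(\<lambda>x. emeasure \<mu> (ball x r)) \<in> borel_measurable \<mu>"
    by (simp add: vimage_def ball_def)
  then show ?thesis
    by (simp add: measure_def)
qed

text \<open>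
  Restricting the supremum to rational radii loses nothing: for \<open>s < r\<close> the measure of the ball only
  decreases, which increases the quotient for a fixed negative denominator, while \<open>log 2 s\<close> is continuous in \<open>s\<close>. The
  convention \<open>log 2 0 = 0\<close> would spoil this monotonicity, so continuity from below is used to find
  radii \<open>b < r\<close> whose ball has positive measure.
\<close>

lemma left_dense_log_ratio:
  fixes \<mu> :: "'a::euclidean_space measure"
  assumes "finite_measure \<mu>" and sets: "sets \<mu> = sets borel" and r: "0 < r" "r < 1"
    and c: "c < log 2 (measure \<mu> (ball x r)) / log 2 r"
  shows "\<exists>s\<in>\<rat> \<inter> {0<..<r}. c < log 2 (measure \<mu> (ball x s)) / log 2 s"
proof -
  interpret finite_measure \<mu> by fact
  let ?m = "\<lambda>s. measure \<mu> (ball x s)"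
  have "\<forall>\<^sub>F s in at_left r. c < log 2 (?m s) / log 2 s"
  proof (cases "?m r = 0")
    case True
    have "?m s = 0" if "s < r" for s
    proof -
      have "?m s \<le> ?m r"
        using that sets by (intro finite_measure_mono) auto
      with True show ?thesis by (simp add: measure_le_0_iff)
    qed
    then show ?thesis
      using c True r(1) by (intro eventually_at_leftI[of 0 r]) (auto simp: log_def)
  next
    case False
    have "\<exists>b<r. 0 < ?m b"
    proof (rule ccontr)
      assume *: "\<not> (\<exists>b<r. 0 < ?m b)"
      have "ball x (r - 1 / real (Suc n)) \<in> null_sets \<mu>" for n
        using * sets by (auto simp: null_sets_def emeasure_eq_measure zero_less_measure_iff)
      then have "(\<Union>n. ball x (r - 1 / real (Suc n))) \<in> null_sets \<mu>"
        by (rule null_sets_UN)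
      also have "(\<Union>n. ball x (r - 1 / real (Suc n))) = ball x r"
      proof (intro equalityI subsetI)
        fix y assume "y \<in> ball x r"
        then obtain n where "inverse (real (Suc n)) < r - dist x y"
          using reals_Archimedean[of "r - dist x y"] by auto
        then have "y \<in> ball x (r - 1 / real (Suc n))"
          by (simp add: inverse_eq_divide)
        then show "y \<in> (\<Union>n. ball x (r - 1 / real (Suc n)))"
          by blast
      qed (auto intro: less_le_trans)
      finally show False
        using False by (simp add: null_sets_def measure_def)
    qed
    then obtain b where b: "b < r" "0 < ?m b" by auto
    have "log 2 r < 0"
      using r by simp
    then have "log 2 r \<noteq> 0"
      by linarith
    then have "((\<lambda>s. log 2 (?m r) / log 2 s) \<longlongrightarrow> log 2 (?m r) / log 2 r) (at_left r)"
      by (intro tendsto_intros) (use r in auto)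
    then have "\<forall>\<^sub>F s in at_left r. c < log 2 (?m r) / log 2 s"
      using c by (rule order_tendstoD)
    moreover have "\<forall>\<^sub>F s in at_left r. s \<in> {max 0 b<..<r}"
      using b r by (intro eventually_at_leftI[of "max 0 b"]) auto
    ultimately show ?thesis
    proof eventually_elim
      case (elim s)
      have "?m b \<le> ?m s"
        using elim sets by (intro finite_measure_mono subset_ball) auto
      moreover have "?m s \<le> ?m r"
        using elim sets by (intro finite_measure_mono subset_ball) auto
      ultimately have "log 2 (?m s) \<le> log 2 (?m r)"
        using b(2) by simp
      moreover have "log 2 s < 0"
        using elim r by simp
      ultimately have "log 2 (?m r) / log 2 s \<le> log 2 (?m s) / log 2 s"
        by (intro divide_right_mono_neg) auto
      with elim show ?case by linarith
    qed
  qed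
  then obtain b where b: "b < r" "\<And>s. b < s \<Longrightarrow> s < r \<Longrightarrow> c < log 2 (?m s) / log 2 s"
    by (auto simp: eventually_at_left[of 0 r, OF r(1)])
  obtain s where "s \<in> \<rat>" "max 0 b < s" "s < r"
    using Rats_dense_in_real[of "max 0 b" r] b r by auto
  with b(2) show ?thesis
    by (intro bexI[of _ s]) auto
qed

lemma upper_local_dim_eq_rational:
  fixes \<mu> :: "'a::euclidean_space measure"
  assumes "finite_measure \<mu>" "sets \<mu> = sets borel"
  shows "upper_local_dim \<mu> x = (INF k::nat. SUP r\<in>\<rat> \<inter> {0<..<1 / real (Suc k)}.
    ereal (log 2 (measure \<mu> (ball x r)) / log 2 r))"
    (is "_ = (INF k. ?S k)")
proof (rule antisym)
  let ?g = "\<lambda>r. ereal (log 2 (measure \<mu> (ball x r)) / log 2 r)"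
  show "upper_local_dim \<mu> x \<le> (INF k. ?S k)"
    unfolding upper_local_dim_def
  proof (intro INF_greatest Limsup_bounded)
    fix k
    have "?g r \<le> ?S k" if r: "r \<in> {0<..<1 / real (Suc k)}" for r
    proof (rule ccontr)
      assume "\<not> ?g r \<le> ?S k"
      then have less: "?S k < ?g r" by simp
      then obtain c where c: "?S k < ereal c" "ereal c < ?g r"
        using ereal_dense2 by blast
      have "1 / real (Suc k) \<le> 1" by simp
      then have "r < 1"
        using r by (meson greaterThanLessThan_iff less_le_trans)
      then obtain s where s: "s \<in> \<rat> \<inter> {0<..<r}" "ereal c < ?g s"
        using left_dense_log_ratio[OF assms, of r c x] r c by auto
      have "?g s \<le> ?S k"
        using s r by (intro SUP_upper) auto
      with s c show False by simp
    qed
    then show "\<forall>\<^sub>F r in at_right 0. ?g r \<le> ?S k"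
      by (intro eventually_at_rightI[of 0 "1 / real (Suc k)"]) auto
  qed
  show "(INF k. ?S k) \<le> upper_local_dim \<mu> x"
    unfolding upper_local_dim_def Limsup_def
  proof (intro INF_greatest)
    fix P :: "real \<Rightarrow> bool" assume "P \<in> {P. eventually P (at_right 0)}"
    then obtain b where b: "0 < b" "\<And>r. 0 < r \<Longrightarrow> r < b \<Longrightarrow> P r"
      by (auto simp: eventually_at_right[of 0 1])
    obtain k where "inverse (real (Suc k)) < b"
      using reals_Archimedean[OF b(1)] by auto
    then have "\<rat> \<inter> {0<..<1 / real (Suc k)} \<subseteq> Collect P"
      using b by (auto simp: inverse_eq_divide)
    then have "?S k \<le> (SUP r\<in>Collect P. ?g r)"
      by (rule SUP_subset_mono) simp
    then show "(INF k. ?S k) \<le> (SUP r\<in>Collect P. ?g r)"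
      by (rule INF_lower2[OF UNIV_I])
  qed
qed

lemma borel_measurable_upper_local_dim:
  fixes \<mu> :: "'a::euclidean_space measure"
  assumes "finite_measure \<mu>" "sets \<mu> = sets borel"
  shows "upper_local_dim \<mu> \<in> borel_measurable \<mu>"
proof -
  have [measurable]: "(\<lambda>x. measure \<mu> (ball x r)) \<in> borel_measurable \<mu>" for r
    by (rule borel_measurable_measure_ball[OF assms])
  have "countable (\<rat> \<inter> {0<..<1 / real (Suc k)})" for k
    using countable_rat by (rule countable_Int1)
  then have "(\<lambda>x. INF k. SUP r\<in>\<rat> \<inter> {0<..<1 / real (Suc k)}.
      ereal (log 2 (measure \<mu> (ball x r)) / log 2 r)) \<in> borel_measurable \<mu>"
    by (intro borel_measurable_INF borel_measurable_SUP) auto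
  then show ?thesis
    by (simp add: upper_local_dim_eq_rational[OF assms, abs_def])
qed

section \<open>From porous balls to the dimension bound\<close>

text \<open>
  The large cube contains \<open>ball x r\<close>, so a set that is small relative to the ball is even smaller
  relative to the cube. The first three scales are lost
  because the cube is three levels coarser than the ball, and \<open>l\<close> levels below the scale of the ball,
  cubes are smaller than the hole.
\<close>

lemma porous_scale_imp_holed:
  fixes \<mu> :: "(real ^ 'd) measure"
  assumes prob: "prob_space \<mu>" and sets: "sets \<mu> = sets borel"
    and \<alpha>: "0 < \<alpha>" and l: "real CARD('d) \<le> \<alpha> * 2 ^ l" and \<epsilon>: "0 \<le> \<epsilon>"
    and por: "\<alpha> < por \<mu> x ((1 / 2) ^ i) \<epsilon>" and i: "3 \<le> i"
  shows "\<exists>\<tau>\<in>shifts. \<exists>a<l + 3. \<exists>j. i = a + j * (l + 3) + 3 \<and>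
    refining_partitions.holed \<mu> (\<lambda>j. grid \<tau> (a + j * (l + 3))) \<epsilon> j x"
proof -
  interpret prob_space \<mu> by fact
  define m where "m = l + 3"
  define n where "n = i - 3"
  define r where "r = 1 / (2::real) ^ i"
  have r: "(1 / 2) ^ i = r" "0 < r" and i_eq: "i = n + 3"
    using i by (simp_all add: r_def n_def power_divide)
  let ?S = "{\<beta>. \<exists>y. ball y (\<beta> * r) \<subseteq> ball x r \<and>
    measure \<mu> (ball y (\<beta> * r)) / measure \<mu> (ball x r) \<le> \<epsilon>}"
  have "0 \<in> ?S"
    using \<epsilon> by simp
  then obtain \<beta> where "\<beta> \<in> ?S" "\<alpha> < \<beta>"
    using por less_cSupD[of ?S \<alpha>] unfolding por_def r by blast
  then obtain y where \<beta>: "\<alpha> < \<beta>" and sub: "ball y (\<beta> * r) \<subseteq> ball x r"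
    and small: "measure \<mu> (ball y (\<beta> * r)) / measure \<mu> (ball x r) \<le> \<epsilon>"
    by blast
  have small': "measure \<mu> (ball y (\<beta> * r)) \<le> \<epsilon> * measure \<mu> (ball x r)"
  proof (cases "measure \<mu> (ball x r) = 0")
    case True
    have "measure \<mu> (ball y (\<beta> * r)) \<le> measure \<mu> (ball x r)"
      using sub sets by (intro finite_measure_mono) auto
    with True show ?thesis by simp
  next
    case False
    then have "0 < measure \<mu> (ball x r)"
      by (simp add: zero_less_measure_iff)
    then show ?thesis
      using small by (simp add: pos_divide_le_eq)
  qed
  obtain \<tau> where \<tau>: "\<tau> \<in> shifts" "\<And>z. z \<in> ball x r \<Longrightarrow> grid \<tau> n z = grid \<tau> n x"
    using ball_in_shifted_cell[where n = n and x = x] unfolding r_def i_eq by blast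
  define a where "a = n mod m"
  define j where "j = n div m"
  have aj: "a < m" "a + j * m = n"
    using mod_div_mult_eq[of n m] by (simp_all add: a_def j_def m_def)
  then have lvl: "a + Suc j * m = n + m"
    by simp
  interpret refining_partitions \<mu> "\<lambda>j. grid \<tau> (a + j * m)" "2 ^ (m * CARD('d))"
    using prob sets by (rule refining_partitions_grid) (simp add: m_def)
  have "y \<in> ball y (\<beta> * r)"
    using \<alpha> \<beta> r by simp
  then have "y \<in> ball x r"
    using sub by blast
  then have y: "grid \<tau> n y = grid \<tau> n x"
    by (rule \<tau>(2))
  have "cell (Suc j) y \<subseteq> ball y (\<beta> * r)"
  proof
    fix z assume "z \<in> cell (Suc j) y"
    then have "grid \<tau> (n + m) z = grid \<tau> (n + m) y"
      by (simp only: cell_def lvl mem_Collect_eq)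
    then have "grid \<tau> (n + m) y = grid \<tau> (n + m) z" ..
    then have "dist y z < real CARD('d) / 2 ^ (n + m)"
      by (rule dist_less_of_grid_eq)
    also have "\<dots> \<le> \<alpha> * 2 ^ l / 2 ^ (n + m)"
      using l by (rule divide_right_mono) simp
    also have "\<dots> = \<alpha> * r"
      by (simp add: r_def i_eq m_def power_add)
    also have "\<dots> \<le> \<beta> * r"
      using \<beta> r by simp
    finally show "z \<in> ball y (\<beta> * r)"
      by simp
  qed
  then have "mass (Suc j) y \<le> measure \<mu> (ball y (\<beta> * r))"
    unfolding mass_def using sets by (intro finite_measure_mono) auto
  also have "\<dots> \<le> \<epsilon> * measure \<mu> (ball x r)"
    by (rule small')
  also have "\<dots> \<le> \<epsilon> * mass j x"
  proof (rule mult_left_mono[OF _ \<epsilon>])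
    have "ball x r \<subseteq> cell j x"
      using \<tau>(2) by (auto simp: cell_def aj)
    then show "measure \<mu> (ball x r) \<le> mass j x"
      unfolding mass_def by (intro finite_measure_mono) auto
  qed
  also have "mass j x = mass j y"
    by (rule mass_cong) (simp add: aj y)
  finally have "hole \<epsilon> j y"
    by (simp add: hole_def)
  moreover have "y \<in> cell j x"
    using y by (simp add: cell_def aj)
  ultimately have "holed \<epsilon> j x"
    by (auto simp: holed_def)
  then show ?thesis
    using \<tau>(1) aj i_eq unfolding m_def by (intro bexI[of _ \<tau>] exI[of _ a] exI[of _ j] conjI) auto
qed

lemma card_porous_scales_le:
  fixes \<mu> :: "(real ^ 'd) measure"
  assumes "prob_space \<mu>" "sets \<mu> = sets borel" "0 < \<alpha>" "real CARD('d) \<le> \<alpha> * 2 ^ l" "0 \<le> \<epsilon>"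
    and J: "n \<le> J * (l + 3)"
  shows "card {i \<in> {..<n}. \<alpha> < por \<mu> x ((1 / 2) ^ i) \<epsilon>} \<le> 3 + (\<Sum>(\<tau>, a)\<in>shifts \<times> {..<l + 3}.
    card {j \<in> {..<J}. refining_partitions.holed \<mu> (\<lambda>j. grid \<tau> (a + j * (l + 3))) \<epsilon> j x})"
proof -
  let ?H = "\<lambda>\<tau> a. {j \<in> {..<J}. refining_partitions.holed \<mu> (\<lambda>j. grid \<tau> (a + j * (l + 3))) \<epsilon> j x}"
  let ?U = "\<Union>(\<tau>, a)\<in>shifts \<times> {..<l + 3}. (\<lambda>j. a + j * (l + 3) + 3) ` ?H \<tau> a"
  have fin: "finite ((shifts :: (real ^ 'd) set) \<times> {..<l + 3})"
    by (intro finite_cartesian_product finite_shifts) simp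
  have "{i \<in> {..<n}. \<alpha> < por \<mu> x ((1 / 2) ^ i) \<epsilon>} \<subseteq> {..<3} \<union> ?U"
  proof
    fix i assume i: "i \<in> {i \<in> {..<n}. \<alpha> < por \<mu> x ((1 / 2) ^ i) \<epsilon>}"
    show "i \<in> {..<3} \<union> ?U"
    proof (cases "i < 3")
      case False
      then obtain \<tau> a j where *: "\<tau> \<in> shifts" "a < l + 3" "i = a + j * (l + 3) + 3"
        "refining_partitions.holed \<mu> (\<lambda>j. grid \<tau> (a + j * (l + 3))) \<epsilon> j x"
        using porous_scale_imp_holed[OF assms(1-5), of x i] i by auto
      have "i < n"
        using i by simp
      then have "j * (l + 3) < J * (l + 3)"
        using *(3) J by linarith
      then have "j < J"
        by (simp only: mult_less_cancel2)
      with * have "j \<in> ?H \<tau> a"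
        by simp
      then have "i \<in> (\<lambda>j. a + j * (l + 3) + 3) ` ?H \<tau> a"
        unfolding *(3) by (rule imageI)
      with * have "i \<in> ?U"
        by (intro UN_I[of "(\<tau>, a)"]) auto
      then show ?thesis by blast
    qed simp
  qed
  then have "card {i \<in> {..<n}. \<alpha> < por \<mu> x ((1 / 2) ^ i) \<epsilon>} \<le> card ({..<3} \<union> ?U)"
    using fin by (intro card_mono) auto
  also have "\<dots> \<le> card {..<3::nat} + card ?U"
    by (rule card_Un_le)
  also have "\<dots> \<le> 3 + (\<Sum>(\<tau>, a)\<in>shifts \<times> {..<l + 3}. card (?H \<tau> a))"
  proof -
    have "card ?U \<le> (\<Sum>p\<in>shifts \<times> {..<l + 3}. card (case p of (\<tau>, a) \<Rightarrow> (\<lambda>j. a + j * (l + 3) + 3) ` ?H \<tau> a))"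
      using fin by (rule card_UN_le)
    also have "\<dots> \<le> (\<Sum>(\<tau>, a)\<in>shifts \<times> {..<l + 3}. card (?H \<tau> a))"
      by (intro sum_mono) (auto intro!: card_image_le split: prod.splits)
    finally show ?thesis by simp
  qed
  finally show ?thesis .
qed

text \<open>
  First \<open>\<kappa>\<close> is chosen to make the weights almost conservative, then \<open>\<eta>\<close> to make up for the cost
  \<open>1 / N - ln \<kappa>\<close> of a visit to a hole.
\<close>

lemma hole_parameters:
  assumes "0 < \<theta>" and N: "0 < (N::real)"
  obtains \<kappa> \<eta> where "0 < \<kappa>" "\<kappa> \<le> 1" "0 < \<eta>" "2 * \<kappa> + \<eta> * (1 / N - ln \<kappa>) < \<theta>"
proof -
  define \<kappa> where "\<kappa> = min 1 (\<theta> / 4)"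
  have \<kappa>: "0 < \<kappa>" "\<kappa> \<le> 1" "2 * \<kappa> \<le> \<theta> / 2"
    using \<open>0 < \<theta>\<close> by (auto simp: \<kappa>_def)
  define X where "X = 1 / N - ln \<kappa>"
  have "0 < 1 / N" "ln \<kappa> \<le> 0"
    using N \<kappa> by auto
  then have X: "0 < X"
    unfolding X_def by linarith
  show thesis
  proof (rule that[of \<kappa> "\<theta> / (3 * X)"])
    have "\<theta> / (3 * X) * X = \<theta> / 3"
      using X by simp
    then show "2 * \<kappa> + \<theta> / (3 * X) * (1 / N - ln \<kappa>) < \<theta>"
      using \<kappa> \<open>0 < \<theta>\<close> unfolding X_def[symmetric] by simp
  qed (use \<kappa> X \<open>0 < \<theta>\<close> in auto)
qed

text \<open>
  For each of the \<open>2\<^sup>d (l + 3)\<close> pairs of a shift and a starting level, the mass of a cell inside the ball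
  bounds the number of cells with holes that have been met. Adding these bounds over all pairs
  controls the number of porous scales in terms of the measure of the ball, which is read
  backwards.
\<close>

lemma AE_ball_mass_bound:
  fixes \<mu> :: "(real ^ 'd) measure"
  assumes prob: "prob_space \<mu>" and sets: "sets \<mu> = sets borel"
    and \<alpha>: "0 < \<alpha>" and l: "real CARD('d) \<le> \<alpha> * 2 ^ l" and \<theta>: "0 < \<theta>"
    and porous: "mean_porous \<mu> \<alpha> \<rho>"
    and G: "G = 1 / (2 ^ ((l + 3) * CARD('d)) * 2 ^ CARD('d) * real (l + 3))"
  shows "AE x in \<mu>. \<forall>\<^sub>F n in sequentially. \<forall>r>real CARD('d) / 2 ^ n.
    0 < measure \<mu> (ball x r) \<and>
    - ln (measure \<mu> (ball x r)) \<le> real n * (real CARD('d) * ln 2 - \<rho> * G + 2 * \<theta>)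
      + (real (l + 3) * real CARD('d) * ln 2 + \<theta> + 3)"
proof -
  interpret prob_space \<mu> by fact
  define d where "d = real CARD('d)"
  define m where "m = l + 3"
  define N where "N = (2::nat) ^ (m * CARD('d))"
  define Q where "Q = (shifts :: (real ^ 'd) set) \<times> {..<m}"
  define q where "q p j = grid (fst p) (snd p + j * m)" for p :: "(real ^ 'd) \<times> nat" and j
  have m: "1 \<le> m"
    by (simp add: m_def)
  have N: "0 < real N"
    by (simp add: N_def)
  have lnN: "ln (real N) = real m * d * ln 2"
    by (simp add: N_def d_def ln_realpow)
  have q: "refining_partitions \<mu> (q p) N" for p
    unfolding q_def N_def using prob sets m by (rule refining_partitions_grid)
  have finQ: "finite Q"
    unfolding Q_def by (intro finite_cartesian_product finite_shifts) simp
  obtain \<kappa> \<eta> where par: "0 < \<kappa>" "\<kappa> \<le> 1" "0 < \<eta>" "2 * \<kappa> + \<eta> * (1 / real N - ln \<kappa>) < \<theta>"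
    using hole_parameters[OF \<theta> N] by blast
  define \<epsilon> where "\<epsilon> = 4 powr (- 1 / \<eta>) / real N"
  have \<epsilon>: "0 < \<epsilon>"
    using N by (simp add: \<epsilon>_def)
  let ?H = "\<lambda>p J x. card {j \<in> {..<J}. refining_partitions.holed \<mu> (q p) \<epsilon> j x}"
  let ?mass = "\<lambda>p. refining_partitions.mass \<mu> (q p)"
  have "AE x in \<mu>. \<forall>p\<in>Q. \<forall>\<^sub>F J in sequentially.
      - ln (?mass p J x) \<le> real J * ln (real N) - real (?H p J x) / real N + \<theta> * real J"
    using refining_partitions.AE_neg_ln_mass_le[OF q par(1,3) \<epsilon>_def par(4,2)]
    by (intro AE_finite_allI finQ)
  moreover have "AE x in \<mu>. \<forall>p\<in>Q. \<forall>J. 0 < ?mass p J x"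
    using refining_partitions.AE_mass_pos[OF q] by (intro AE_finite_allI finQ)
  moreover have "AE x in \<mu>. ereal \<rho> \<le> liminf (\<lambda>n. ereal (real (card {i \<in> {..<n}. por \<mu> x ((1 / 2) ^ i) \<epsilon> > \<alpha>}) / real n))"
    using porous \<epsilon> by (simp add: mean_porous_def weakly_mean_porous_def)
  ultimately show ?thesis
  proof eventually_elim
    case (elim x)
    let ?I = "\<lambda>n. real (card {i \<in> {..<n}. por \<mu> x ((1 / 2) ^ i) \<epsilon> > \<alpha>})"
    have "\<forall>\<^sub>F J in sequentially. \<forall>p\<in>Q.
        - ln (?mass p J x) \<le> real J * ln (real N) - real (?H p J x) / real N + \<theta> * real J"
      using elim(1) finQ by (intro eventually_ball_finite)
    moreover have "filterlim (\<lambda>n. Suc (n div m)) sequentially sequentially"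
      using m by (intro filterlim_compose[OF filterlim_Suc filterlim_at_top_div_const_nat]) simp
    ultimately have "\<forall>\<^sub>F n in sequentially. \<forall>p\<in>Q.
        - ln (?mass p (Suc (n div m)) x) \<le> real (Suc (n div m)) * ln (real N)
          - real (?H p (Suc (n div m)) x) / real N + \<theta> * real (Suc (n div m))"
      by (rule eventually_compose_filterlim)
    moreover have "\<forall>\<^sub>F n in sequentially. ereal (\<rho> - \<theta>) < ereal (?I n / real n)"
      using elim(3)[unfolded le_Liminf_iff, rule_format, of "ereal (\<rho> - \<theta>)"] \<theta> by simp
    moreover have "\<forall>\<^sub>F n in sequentially. 0 < n"
      by (rule eventually_gt_at_top)
    ultimately show ?case
    proof eventually_elim
      case (elim n)
      define J where "J = Suc (n div m)"
      have "n div m * m + n mod m = n" "n mod m < m" "n div m \<le> n" "J * m = n div m * m + m"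
        using m by (simp_all only: div_mult_mod_eq J_def mult_Suc) simp_all
      then have J: "n \<le> J * m" "J * m \<le> n + m" "J \<le> n + 1"
        unfolding J_def by linarith+
      show ?case
      proof (intro allI impI)
        fix r assume r: "r > real CARD('d) / 2 ^ n"
        define b where "b = - ln (measure \<mu> (ball x r))"
        have mass_le: "?mass p J x \<le> measure \<mu> (ball x r)" for p
        proof -
          interpret refining_partitions \<mu> "q p" N by (rule q)
          have "cell J x \<subseteq> ball x r"
          proof
            fix z assume "z \<in> cell J x"
            then have "grid (fst p) (snd p + J * m) x = grid (fst p) (snd p + J * m) z"
              by (simp add: cell_def q_def)
            then have "dist x z < real CARD('d) / 2 ^ (snd p + J * m)"
              by (rule dist_less_of_grid_eq)
            also have "\<dots> \<le> real CARD('d) / 2 ^ n"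
              using J(1) by (intro divide_left_mono power_increasing) auto
            finally show "z \<in> ball x r"
              using r by simp
          qed
          then show ?thesis
            unfolding mass_def using sets by (intro finite_measure_mono) auto
        qed
        obtain p0 where "p0 \<in> Q"
        proof -
          have "(0 :: real ^ 'd) \<in> shifts"
            by (simp add: shifts_def)
          then show thesis
            using m by (intro that[of "(0, 0)"]) (auto simp: Q_def)
        qed
        then have pos: "0 < measure \<mu> (ball x r)"
          using mass_le[of p0] \<open>\<forall>p\<in>Q. \<forall>J. 0 < ?mass p J x\<close> by (meson less_le_trans)
        \<comment> \<open>\<open>X\<close> is by how much the bound for the measure of the ball improves on the one without holes.\<close>
        define X where "X = real J * ln (real N) + \<theta> * real J - b"
        have H: "real (?H p J x) \<le> real N * X" if p: "p \<in> Q" for p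
        proof -
          have "ln (?mass p J x) \<le> ln (measure \<mu> (ball x r))"
            using mass_le[of p] \<open>\<forall>p\<in>Q. \<forall>J. 0 < ?mass p J x\<close> p pos by (subst ln_le_cancel_iff) auto
          moreover have "- ln (?mass p J x) \<le> real J * ln (real N) - real (?H p J x) / real N + \<theta> * real J"
            using elim(1) p unfolding J_def by blast
          ultimately have "real (?H p J x) / real N \<le> X"
            unfolding X_def b_def by linarith
          then show ?thesis
            using N by (simp add: pos_divide_le_eq mult.commute)
        qed
        have X: "0 \<le> X"
          using order_trans[OF of_nat_0_le_iff H[OF \<open>p0 \<in> Q\<close>]] N by (simp add: zero_le_mult_iff)
        have "real (card Q) \<le> 2 ^ CARD('d) * real m"
        proof -
          have "card Q \<le> 2 ^ CARD('d) * m"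
            using card_shifts[where 'd = 'd] by (simp add: Q_def card_cartesian_product)
          then have "real (card Q) \<le> real (2 ^ CARD('d) * m)"
            by (simp only: of_nat_le_iff)
          then show ?thesis by simp
        qed
        then have "real (card Q) * (real N * X) \<le> 2 ^ CARD('d) * real m * (real N * X)"
          using X N by (intro mult_right_mono) auto
        moreover have "(\<Sum>p\<in>Q. real (?H p J x)) \<le> real (card Q) * (real N * X)"
          using H by (rule sum_bounded_above)
        moreover have "?I n \<le> 3 + (\<Sum>p\<in>Q. real (?H p J x))"
        proof -
          have "card {i \<in> {..<n}. por \<mu> x ((1 / 2) ^ i) \<epsilon> > \<alpha>} \<le> 3 + (\<Sum>p\<in>Q. ?H p J x)"
            using card_porous_scales_le[OF prob sets \<alpha> l less_imp_le[OF \<epsilon>], of n J x] J(1)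
            unfolding Q_def q_def m_def case_prod_beta by simp
          then have "?I n \<le> real (3 + (\<Sum>p\<in>Q. ?H p J x))"
            by (simp only: of_nat_le_iff)
          then show ?thesis by simp
        qed
        ultimately have "?I n - 3 \<le> 2 ^ CARD('d) * real m * (real N * X)"
          by linarith
        also have "\<dots> = X / G"
          by (simp add: G N_def m_def mult_ac)
        finally have count: "G * (?I n - 3) \<le> X"
        proof -
          assume *: "?I n - 3 \<le> X / G"
          have "0 < G" by (simp add: G)
          with * show ?thesis by (simp add: pos_le_divide_eq mult.commute)
        qed
        have G01: "0 \<le> G" "G \<le> 1"
        proof -
          have "1 * 1 * 1 \<le> 2 ^ ((l + 3) * CARD('d)) * 2 ^ CARD('d) * real (l + 3)"
            by (intro mult_mono one_le_power) auto
          then show "0 \<le> G" "G \<le> 1"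
            by (simp_all add: G)
        qed
        have "(\<rho> - \<theta>) * real n \<le> ?I n"
          using elim(2,3) by (simp add: pos_less_divide_eq less_imp_le)
        then have "G * ((\<rho> - \<theta>) * real n - 3) \<le> G * (?I n - 3)"
          using G01 by (intro mult_left_mono) auto
        moreover have "G * (\<theta> * real n) \<le> \<theta> * real n"
          using G01 \<theta> by (intro mult_left_le_one_le) auto
        ultimately have lower: "\<rho> * G * real n - \<theta> * real n - 3 \<le> X"
          using count G01 by (simp add: algebra_simps)
        have "real J * real m \<le> real n + real m"
          using J(2) by (metis of_nat_add of_nat_le_iff of_nat_mult)
        then have "(real J * real m) * (d * ln 2) \<le> (real n + real m) * (d * ln 2)"
          by (rule mult_right_mono) (simp add: d_def)
        then have "real J * ln (real N) \<le> (real n + real m) * (d * ln 2)"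
          by (simp add: lnN mult_ac)
        moreover have "\<theta> * real J \<le> \<theta> * (real n + 1)"
          using J(3) \<theta> by (intro mult_left_mono) auto
        ultimately have "b \<le> real n * (d * ln 2 - \<rho> * G + 2 * \<theta>) + (real m * d * ln 2 + \<theta> + 3)"
          using lower unfolding X_def by (simp add: algebra_simps)
        with pos show "0 < measure \<mu> (ball x r) \<and>
            - ln (measure \<mu> (ball x r)) \<le> real n * (real CARD('d) * ln 2 - \<rho> * G + 2 * \<theta>)
              + (real (l + 3) * real CARD('d) * ln 2 + \<theta> + 3)"
          unfolding b_def d_def m_def by blast
      qed
    qed
  qed
qed

text \<open>
  The passage from the scales \<open>D / 2\<^sup>n\<close> to arbitrary radii: the least \<open>n\<close> with
  \<open>D / 2\<^sup>n < r\<close> differs from \<open>- log 2 r\<close> by a bounded amount, which vanishes after division by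
  \<open>log 2 r\<close>.
\<close>

lemma eventually_log_ratio_le:
  fixes f :: "real \<Rightarrow> real"
  assumes D: "0 < D" and c: "0 \<le> c" and e: "0 < e"
    and bound: "\<forall>\<^sub>F n in sequentially. \<forall>r>D / 2 ^ n. 0 < f r \<and> - ln (f r) \<le> real n * c + K"
  shows "\<forall>\<^sub>F r in at_right 0. log 2 (f r) / log 2 r \<le> c / ln 2 + e"
proof -
  obtain n0 where n0: "\<And>n r. n0 \<le> n \<Longrightarrow> D / 2 ^ n < r \<Longrightarrow> 0 < f r \<and> - ln (f r) \<le> real n * c + K"
    using bound unfolding eventually_sequentially by blast
  define K1 where "K1 = \<bar>((log 2 D + 1) * c + K) / ln 2\<bar>"
  define r0 where "r0 = min (D / 2 ^ n0) (2 powr (- (K1 / e + 1)))"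
  have "0 < r0"
    using D by (simp add: r0_def)
  moreover have "log 2 (f r) / log 2 r \<le> c / ln 2 + e" if r: "0 < r" "r < r0" for r
  proof -
    define R where "R = - log 2 r"
    have "log 2 r < log 2 (2 powr (- (K1 / e + 1)))"
      using r by (subst log_less_cancel_iff) (auto simp: r0_def)
    then have R: "K1 / e + 1 < R"
      by (simp add: R_def)
    moreover have "0 \<le> K1 / e"
      using e by (simp add: K1_def)
    ultimately have R0: "0 < R"
      by linarith
    have "2 ^ n0 < D / r"
      using r by (simp add: r0_def field_simps)
    then have "log 2 (2 powr real n0) < log 2 (D / r)"
      using D r by (subst log_less_cancel_iff) (auto simp: powr_realpow)
    then have big: "real n0 < log 2 (D / r)"
      by simp
    define n where "n = Suc (nat \<lfloor>log 2 (D / r)\<rfloor>)"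
    have n: "log 2 (D / r) < real n" "real n \<le> log 2 (D / r) + 1"
      using big unfolding n_def by linarith+
    have "n0 \<le> n"
      using big n by linarith
    moreover have "D / 2 ^ n < r"
    proof -
      have "D / r = 2 powr log 2 (D / r)"
        using D r by simp
      also have "\<dots> < 2 powr real n"
        using n by (intro powr_less_mono) auto
      finally show ?thesis
        using r by (simp add: powr_realpow field_simps)
    qed
    ultimately have f: "0 < f r" "- ln (f r) \<le> real n * c + K"
      using n0 by blast+
    have "log 2 (D / r) = log 2 D + R"
      using D r by (simp add: log_divide R_def)
    then have "real n * c \<le> (log 2 D + R + 1) * c"
      using n c by (intro mult_right_mono) auto
    with f have "- ln (f r) \<le> R * c + ((log 2 D + 1) * c + K)"
      by (simp add: algebra_simps)
    then have "- ln (f r) / ln 2 \<le> (R * c + ((log 2 D + 1) * c + K)) / ln 2"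
      by (rule divide_right_mono) simp
    also have "\<dots> \<le> R * (c / ln 2) + K1"
      using abs_ge_self[of "((log 2 D + 1) * c + K) / ln 2"]
      unfolding K1_def add_divide_distrib[of "R * c"] times_divide_eq_right by (rule add_left_mono)
    also have "K1 \<le> R * e"
    proof -
      have "K1 / e \<le> R"
        using R by linarith
      then show ?thesis
        using e by (simp add: pos_divide_le_eq)
    qed
    finally have "- log 2 (f r) \<le> R * (c / ln 2 + e)"
      by (simp add: log_def algebra_simps)
    then have "- log 2 (f r) / R \<le> c / ln 2 + e"
      by (subst pos_divide_le_eq[OF R0]) (simp add: mult.commute)
    then show ?thesis
      by (simp add: R_def)
  qed
  ultimately show ?thesis
    by (intro eventually_at_rightI[of 0 r0]) auto
qed

text \<open>
  The error \<open>\<theta>\<close> of the previous estimates runs through the sequence \<open>1 / (k + 1)\<close>, so that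
  countably many null sets suffice.
\<close>

lemma upper_packing_dim_le:
  fixes \<mu> :: "(real ^ 'd) measure"
  assumes prob: "prob_space \<mu>" and sets: "sets \<mu> = sets borel"
    and \<alpha>: "0 < \<alpha>" and l: "real CARD('d) \<le> \<alpha> * 2 ^ l" and \<rho>: "0 \<le> \<rho>" "\<rho> \<le> 1"
    and porous: "mean_porous \<mu> \<alpha> \<rho>"
    and G: "G = 1 / (2 ^ ((l + 3) * CARD('d)) * 2 ^ CARD('d) * real (l + 3))"
  shows "upper_packing_dim \<mu> \<le> ereal (real CARD('d) - \<rho> * G)"
proof -
  interpret prob_space \<mu> by fact
  define d where "d = real CARD('d)"
  define c where "c k = d * ln 2 - \<rho> * G + 2 * (1 / real (Suc k))" for k
  have d: "1 \<le> d"
    unfolding d_def by (simp add: Suc_le_eq)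
  have G01: "0 \<le> G" "G \<le> 1 / 2"
  proof -
    have "(2::real) ^ 1 \<le> 2 ^ CARD('d)"
      by (intro power_increasing) (auto simp: Suc_le_eq)
    then have "1 * 2 * 1 \<le> 2 ^ ((l + 3) * CARD('d)) * 2 ^ CARD('d) * real (l + 3)"
      by (intro mult_mono one_le_power) auto
    then show "0 \<le> G" "G \<le> 1 / 2"
      by (simp_all add: G field_simps)
  qed
  have "\<rho> * G \<le> 1 * (1 / 2)"
    using \<rho> G01 by (intro mult_mono) auto
  moreover have "1 / 2 \<le> d * ln 2"
    using d ln2_ge_two_thirds mult_mono[of 1 d "2 / 3" "ln 2"] by simp
  ultimately have c: "0 \<le> c k" for k
    unfolding c_def by (intro add_nonneg_nonneg) auto
  have c_le: "c k / ln 2 \<le> d - \<rho> * G + 4 * (1 / real (Suc k))" for k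
  proof -
    have "\<rho> * G \<le> \<rho> * G / ln 2"
      using \<rho> G01 ln_2_less_1 by (simp add: pos_le_divide_eq mult_left_le)
    moreover have "2 * (1 / real (Suc k)) / ln 2 \<le> 4 * (1 / real (Suc k))"
      using ln2_ge_two_thirds by (simp add: pos_divide_le_eq divide_right_mono)
    moreover have "c k / ln 2 = d - \<rho> * G / ln 2 + 2 * (1 / real (Suc k)) / ln 2"
      by (simp add: c_def diff_divide_distrib add_divide_distrib)
    ultimately show ?thesis by linarith
  qed
  have "AE x in \<mu>. \<forall>k. \<forall>\<^sub>F n in sequentially. \<forall>r>d / 2 ^ n. 0 < measure \<mu> (ball x r) \<and>
      - ln (measure \<mu> (ball x r)) \<le> real n * c k + (real (l + 3) * d * ln 2 + 1 / real (Suc k) + 3)"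
    unfolding AE_all_countable c_def d_def
    by (intro allI AE_ball_mass_bound[OF prob sets \<alpha> l _ porous G]) simp
  then have "AE x in \<mu>. upper_local_dim \<mu> x \<le> ereal (d - \<rho> * G)"
  proof eventually_elim
    case (elim x)
    show ?case
    proof (rule ereal_le_epsilon2)
      fix e :: real assume e: "0 < e"
      obtain k where k: "inverse (real (Suc k)) < e / 5"
        using reals_Archimedean[of "e / 5"] e by auto
      have "\<forall>\<^sub>F r in at_right 0. log 2 (measure \<mu> (ball x r)) / log 2 r \<le> c k / ln 2 + e / 5"
        using d e by (intro eventually_log_ratio_le[OF _ c _ elim[rule_format]]) auto
      then have "\<forall>\<^sub>F r in at_right 0. ereal (log 2 (measure \<mu> (ball x r)) / log 2 r) \<le> ereal (d - \<rho> * G) + ereal e"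
      proof eventually_elim
        case (elim r)
        then show ?case
          using c_le[of k] k by (simp add: inverse_eq_divide)
      qed
      then show "upper_local_dim \<mu> x \<le> ereal (d - \<rho> * G) + ereal e"
        unfolding upper_local_dim_def by (rule Limsup_bounded)
    qed
  qed
  moreover have "upper_local_dim \<mu> \<in> borel_measurable \<mu>"
    by (rule borel_measurable_upper_local_dim[OF finite_measure_axioms sets])
  ultimately show ?thesis
    unfolding upper_packing_dim_def d_def by (intro esssup_I)
qed

text \<open>
  It remains to choose the number \<open>l\<close> of levels minimal, so that \<open>2\<^sup>l\<close> lies between \<open>d / \<alpha>\<close> and
  \<open>2 d / \<alpha>\<close>. Then \<open>2\<^sup>(\<^sup>l\<^sup>+\<^sup>3\<^sup>)\<^sup>d 2\<^sup>d \<le> (32 d / \<alpha>)\<^sup>d\<close>, and \<open>l + 3\<close> is at most \<open>5 + log d\<close> times \<open>|log \<alpha>|\<close>, as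
  \<open>\<alpha> \<le> 1 / 2\<close> makes \<open>|log \<alpha>| \<ge> 1\<close>.
\<close>

theorem proposition9:
  shows "\<exists>C::real. C > 0 \<and>
    (\<forall>(\<alpha>::real) (\<rho>::real) (\<mu> :: (real ^ 'd) measure).
       0 < \<alpha> \<longrightarrow> \<alpha> \<le> 1 / 2 \<longrightarrow> 0 \<le> \<rho> \<longrightarrow> \<rho> \<le> 1 \<longrightarrow>
       sets \<mu> = sets borel \<longrightarrow> prob_space \<mu> \<longrightarrow> mean_porous \<mu> \<alpha> \<rho> \<longrightarrow>
       upper_packing_dim \<mu> \<le>
         ereal (real CARD('d) - C * \<rho> * \<alpha> ^ CARD('d) / \<bar>log 2 \<alpha>\<bar>))"
proof -
  define d where "d = real CARD('d)"
  define B where "B = 5 + log 2 d"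
  define C where "C = 1 / ((32 * d) ^ CARD('d) * B)"
  have d: "1 \<le> d"
    unfolding d_def by (simp add: Suc_le_eq)
  then have logd: "0 \<le> log 2 d"
    by simp
  then have B: "0 < B"
    by (simp add: B_def)
  have C: "0 < C"
    using d B by (simp add: C_def)
  show ?thesis
  proof (intro exI[of _ C] conjI allI impI)
    fix \<alpha> \<rho> :: real and \<mu> :: "(real ^ 'd) measure"
    assume \<alpha>: "0 < \<alpha>" "\<alpha> \<le> 1 / 2" and \<rho>: "0 \<le> \<rho>" "\<rho> \<le> 1"
      and \<mu>: "sets \<mu> = sets borel" "prob_space \<mu>" "mean_porous \<mu> \<alpha> \<rho>"
    define \<Lambda> where "\<Lambda> = \<bar>log 2 \<alpha>\<bar>"
    have "log 2 \<alpha> \<le> log 2 (1 / 2)"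
      using \<alpha> by (subst log_le_cancel_iff) auto
    then have \<Lambda>: "1 \<le> \<Lambda>" "\<Lambda> = - log 2 \<alpha>"
      by (auto simp: \<Lambda>_def log_divide)
    have logda: "log 2 (d / \<alpha>) = log 2 d + \<Lambda>"
      using d \<alpha> \<Lambda> by (simp add: log_divide)
    define l where "l = nat \<lceil>log 2 (d / \<alpha>)\<rceil>"
    have l: "log 2 (d / \<alpha>) \<le> real l" "real l \<le> log 2 (d / \<alpha>) + 1"
      using logd \<Lambda> unfolding l_def logda by linarith+
    have "d / \<alpha> = 2 powr log 2 (d / \<alpha>)"
      using d \<alpha> by simp
    also have "\<dots> \<le> 2 powr real l"
      using l by (intro powr_mono) auto
    finally have fine: "real CARD('d) \<le> \<alpha> * 2 ^ l"
      using \<alpha> by (simp add: powr_realpow pos_divide_le_eq d_def mult.commute)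
    have "2 powr real l \<le> 2 powr (log 2 (d / \<alpha>) + 1)"
      using l by (intro powr_mono) auto
    also have "\<dots> = 2 * (d / \<alpha>)"
      using d \<alpha> by (simp add: powr_add)
    finally have coarse: "2 ^ l \<le> 2 * (d / \<alpha>)"
      by (simp add: powr_realpow)
    define G where "G = 1 / (2 ^ ((l + 3) * CARD('d)) * 2 ^ CARD('d) * real (l + 3))"
    have "C * \<rho> * \<alpha> ^ CARD('d) / \<Lambda> \<le> \<rho> * G"
    proof -
      have "2 ^ (l + 3) * 2 \<le> 32 * d / \<alpha>"
        using coarse by (simp add: power_add)
      then have "(2 ^ (l + 3) * 2) ^ CARD('d) \<le> (32 * d / \<alpha>) ^ CARD('d)"
        by (intro power_mono) auto
      moreover have "real (l + 3) \<le> B * \<Lambda>"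
      proof -
        have "log 2 d * 1 \<le> log 2 d * \<Lambda>"
          using logd \<Lambda> by (intro mult_left_mono) auto
        then show ?thesis
          using l \<Lambda> unfolding B_def logda by (simp add: algebra_simps)
      qed
      ultimately have "(2 ^ (l + 3) * 2) ^ CARD('d) * real (l + 3) \<le> (32 * d / \<alpha>) ^ CARD('d) * (B * \<Lambda>)"
        using d \<alpha> by (intro mult_mono) auto
      then have "1 / ((32 * d / \<alpha>) ^ CARD('d) * (B * \<Lambda>)) \<le> G"
        unfolding G_def power_mult power_mult_distrib[symmetric] by (intro frac_le) auto
      moreover have "1 / ((32 * d / \<alpha>) ^ CARD('d) * (B * \<Lambda>)) = C * \<alpha> ^ CARD('d) / \<Lambda>"
        by (simp add: C_def power_divide)
      ultimately have "\<rho> * (C * \<alpha> ^ CARD('d) / \<Lambda>) \<le> \<rho> * G"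
        using \<rho> by (intro mult_left_mono) auto
      then show ?thesis
        by (simp add: mult_ac)
    qed
    moreover have "upper_packing_dim \<mu> \<le> ereal (real CARD('d) - \<rho> * G)"
      by (rule upper_packing_dim_le[OF \<mu>(2,1) \<alpha>(1) fine \<rho> \<mu>(3) G_def])
    ultimately show "upper_packing_dim \<mu> \<le> ereal (real CARD('d) - C * \<rho> * \<alpha> ^ CARD('d) / \<bar>log 2 \<alpha>\<bar>)"
      unfolding \<Lambda>_def by (elim order_trans) simp
  qed (rule C)
qed

end
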